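(* Let $s\in(0,1)$, $N>2s$, $f\in C^2$, and let $u\in\dot H^s(\mathbb{R}^N)\cap L^\infty(\mathbb{R}^N)$ be a positive (weak) solution of $$(-\Delta)^su=f(u)\quad\text{in }\mathbb{R}^N .$$ Let $F(u)=\int_0^uf(t)\,dt$ and assume $F(u)\in L^1(\mathbb{R}^N)$. Then $$(N-2s)\int_{\mathbb{R}^N}uf(u)\,dx=2N\int_{\mathbb{R}^N}F(u)\,dx .$$
   Context: $2^*=\frac{2N}{N-2s}$ and $c_{N,s}=\frac{2^{2s}s\,\Gamma(\frac N2+s)}{\pi^{N/2}\Gamma(1-s)}$. Set $\|u\|^2_{\dot H^s(\mathbb{R}^N)}=\frac{c_{N,s}}{2}\int_{\mathbb{R}^N}\int_{\mathbb{R}^N}\frac{|u(x)-u(y)|^2}{|x-y|^{N+2s}}\,dx\,dy$; $\dot H^s(\mathbb{R}^N)$ is the completion of $C_0^\infty(\mathbb{R}^N)$ with respect to $\|u\|_{\dot H^s(\mathbb{R}^N)}+|u|_{L^{2^*}(\mathbb{R}^N)}$. A weak solution of $(-\Delta)^su=f(u)$ in $\mathbb{R}^N$ is a function $u\in\dot H^s(\mathbb{R}^N)$ such that for every $\varphi\in\dot H^s(\mathbb{R}^N)$ $$\frac{c_{N,s}}{2}\int_{\mathbb{R}^N}\int_{\mathbb{R}^N}\frac{(u(x)-u(y))(\varphi(x)-\varphi(y))}{|x-y|^{N+2s}}\,dx\,dy=\int_{\mathbb{R}^N}f(u)\varphi\,dx .$$ *)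

theory Defs
  imports "HOL-Analysis.Analysis"
begin

text \<open>
  Throughout, \<open>\<real>\<^sup>N\<close> is an arbitrary Euclidean space \<open>'a\<close>, with \<open>N = DIM('a)\<close>.
\<close>

subsection \<open>Smooth functions\<close>

text \<open>Functions of class \<open>C\<^sup>k\<close>, by recursion over the directional derivatives.\<close>

primrec C_class :: "nat \<Rightarrow> ('a::real_normed_vector \<Rightarrow> 'b::real_normed_vector) \<Rightarrow> bool" where
  "C_class 0 g \<longleftrightarrow> continuous_on UNIV g"
| "C_class (Suc k) g \<longleftrightarrow>
     (\<forall>x. g differentiable (at x)) \<and> (\<forall>v. C_class k (\<lambda>x. frechet_derivative g (at x) v))"

definition test_function :: "('a::euclidean_space \<Rightarrow> real) \<Rightarrow> bool" where
  "test_function \<phi> \<longleftrightarrow> (\<forall>k. C_class k \<phi>) \<and> compact (closure (support_on UNIV \<phi>))"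

subsection \<open>The space \<open>\<dot>H\<^sup>s(\<real>\<^sup>N)\<close>\<close>

definition crit_exp :: "'a::euclidean_space itself \<Rightarrow> real \<Rightarrow> real" where
  "crit_exp _ s = 2 * real DIM('a) / (real DIM('a) - 2 * s)"

definition frac_const :: "'a::euclidean_space itself \<Rightarrow> real \<Rightarrow> real" where
  "frac_const _ s =
     2 powr (2 * s) * s * Gamma (real DIM('a) / 2 + s)
       / (pi powr (real DIM('a) / 2) * Gamma (1 - s))"

text \<open>On the diagonal, a null set, the quotient is \<open>0\<close> by the convention \<open>x / 0 = 0\<close>.\<close>

definition energy_density ::
    "real \<Rightarrow> ('a::euclidean_space \<Rightarrow> real) \<Rightarrow> ('a \<Rightarrow> real) \<Rightarrow> 'a \<times> 'a \<Rightarrow> real" where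
  "energy_density s u \<phi> = (\<lambda>(x, y).
     (u x - u y) * (\<phi> x - \<phi> y) / norm (x - y) powr (real DIM('a) + 2 * s))"

definition energy_form ::
    "real \<Rightarrow> ('a::euclidean_space \<Rightarrow> real) \<Rightarrow> ('a \<Rightarrow> real) \<Rightarrow> real" where
  "energy_form s u \<phi> =
     frac_const TYPE('a) s / 2 *
       (LINT z|(lebesgue \<Otimes>\<^sub>M lebesgue). energy_density s u \<phi> z)"

definition Lp_norm :: "real \<Rightarrow> ('a::euclidean_space \<Rightarrow> real) \<Rightarrow> real" where
  "Lp_norm p u = (LINT x|lebesgue. \<bar>u x\<bar> powr p) powr (1 / p)"

definition Hdot_norm :: "real \<Rightarrow> ('a::euclidean_space \<Rightarrow> real) \<Rightarrow> real" where
  "Hdot_norm s u = sqrt (energy_form s u u) + Lp_norm (crit_exp TYPE('a) s) u"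

text \<open>
  The measurable functions on which the norm is finite. Two functions that agree almost
  everywhere represent the same element of the space.
\<close>

definition finite_Hdot_norm :: "real \<Rightarrow> ('a::euclidean_space \<Rightarrow> real) set" where
  "finite_Hdot_norm s =
     {u \<in> borel_measurable lebesgue.
        integrable (lebesgue \<Otimes>\<^sub>M lebesgue) (energy_density s u u) \<and>
        integrable lebesgue (\<lambda>x. \<bar>u x\<bar> powr crit_exp TYPE('a) s)}"

text \<open>
  The completion of the test functions, realised as their closure in the space above.
  That space is complete: a Cauchy sequence converges in \<open>L\<^bsup>2*\<^esup>\<close>, and its difference quotients
  converge in \<open>L\<^sup>2\<close> on pairs, necessarily to the difference quotient of the \<open>L\<^bsup>2*\<^esup>\<close>-limit.
\<close>

definition Hdot :: "real \<Rightarrow> ('a::euclidean_space \<Rightarrow> real) set" where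
  "Hdot s =
     {u \<in> finite_Hdot_norm s.
        \<exists>\<phi>. (\<forall>k. test_function (\<phi> k)) \<and>
            (\<lambda>k::nat. Hdot_norm s (\<lambda>x. u x - \<phi> k x)) \<longlonglongrightarrow> 0}"

subsection \<open>Weak solutions\<close>

text \<open>
  Integrability of \<open>f(u)\<phi>\<close> is what gives the right-hand side of the identity a meaning; the
  left-hand side converges absolutely by the Cauchy-Schwarz inequality.
\<close>

definition weak_solution ::
    "real \<Rightarrow> (real \<Rightarrow> real) \<Rightarrow> ('a::euclidean_space \<Rightarrow> real) \<Rightarrow> bool" where
  "weak_solution s f u \<longleftrightarrow>
     u \<in> Hdot s \<and>
     (\<forall>\<phi> \<in> Hdot s.
        integrable lebesgue (\<lambda>x. f (u x) * \<phi> x) \<and>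
        energy_form s u \<phi> = (LINT x|lebesgue. f (u x) * \<phi> x))"

definition primitive :: "(real \<Rightarrow> real) \<Rightarrow> real \<Rightarrow> real" where
  "primitive f r = (LBINT t=0..ereal r. f t)"

definition essentially_bounded :: "('a::euclidean_space \<Rightarrow> real) \<Rightarrow> bool" where
  "essentially_bounded u \<longleftrightarrow>
     u \<in> borel_measurable lebesgue \<and> (\<exists>C. AE x in lebesgue. \<bar>u x\<bar> \<le> C)"

end

theory Submission
  imports Defs
begin

text \<open>
  The identity is the stationarity of the action under dilations. Since nothing is known about the
  decay of \<open>u\<close>, a dilation is replaced by the map \<open>x\<^sub>b \<mapsto> x\<^sub>b + t R sin (x\<^sub>b / R)\<close> (for each
  coordinate \<open>b\<close>), which moves points by a bounded distance and behaves like the dilation by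
  \<open>1 + t\<close> as \<open>R \<rightarrow> \<infinity>\<close>. Write \<open>v\<close> for \<open>u\<close> composed with this map, and \<open>E\<close> for the energy. The weak
  equation and Taylor's formula for \<open>F\<close> give
  \<open>0 \<le> E(v - u) \<le> E(v) - E(u) - 2 (\<integral>F(v) - \<integral>F(u)) + 2 L \<integral>(v - u)\<^sup>2\<close>,
  where by a change of variables \<open>E(v)\<close> and \<open>\<integral>F(v)\<close> are differentiable in \<open>t\<close> whatever the regularity
  of \<open>u\<close>. If the last term is \<open>o(t)\<close>, then dividing by \<open>t > 0\<close> and by \<open>t < 0\<close> gives the identity.

  For translations the same inequality reads \<open>E(\<Delta>\<^sub>h u) \<le> 2 L \<parallel>\<Delta>\<^sub>h u\<parallel>\<^sup>2\<close> with the \<open>L\<^sup>2\<close>-norm. As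
  \<open>\<parallel>\<Delta>\<^sub>h w\<parallel>\<^sup>2 \<le> C |h|\<^bsup>2s\<^esup> E(w)\<close> for all \<open>w\<close>, the second difference \<open>\<Delta>\<^sub>h \<Delta>\<^sub>h u\<close> is small compared to
  \<open>\<Delta>\<^sub>h u\<close>, so \<open>2 \<Delta>\<^sub>h u = \<Delta>\<^sub>2\<^sub>h u - \<Delta>\<^sub>h \<Delta>\<^sub>h u\<close> yields \<open>\<parallel>\<Delta>\<^sub>h u\<parallel>\<^sup>2 = O(|h|\<^bsup>5/4\<^esup>)\<close>. Averaging over \<open>h\<close>
  bounds \<open>\<integral>(v - u)\<^sup>2\<close> by \<open>O((|t| R)\<^bsup>5/4\<^esup>)\<close>, which is \<open>o(t)\<close> for \<open>R = m\<close> and \<open>|t| = m\<^bsup>-9\<^esup>\<close>.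
\<close>

subsection \<open>Passing from Lebesgue to Borel measure\<close>

text \<open>\<open>lebesgue \<Otimes>\<^sub>M lebesgue\<close> is a product of completions, not the
  completion of a product, so integrals over it are not reduced to Borel ones by the rules for
  \<open>completion\<close>. The identity map transfers them instead: it pushes each factor, and
  hence the product, to Borel measure.\<close>

lemma distr_lebesgue_pair:
  "distr (lebesgue \<Otimes>\<^sub>M lebesgue) (borel \<Otimes>\<^sub>M borel) (\<lambda>z. z) =
    (lborel \<Otimes>\<^sub>M lborel :: ('a::euclidean_space \<times> 'a) measure)"
proof -
  have eq: "distr lebesgue borel (\<lambda>x. x) = (lborel :: 'a measure)"
    by (subst distr_completion) (auto intro!: measure_eqI simp: emeasure_distr)
  have "distr lebesgue borel (\<lambda>x. x) \<Otimes>\<^sub>M distr lebesgue borel (\<lambda>x. x) =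
     distr (lebesgue \<Otimes>\<^sub>M lebesgue) (borel \<Otimes>\<^sub>M borel) (\<lambda>(x::'a, y::'a). (x, y))"
    by (rule pair_measure_distr)
      (auto simp: eq sigma_finite_lborel intro!: measurable_completion)
  then show ?thesis by (simp add: eq split_beta')
qed

lemma
  fixes h :: "'a::euclidean_space \<times> 'a \<Rightarrow> real"
  assumes [measurable]: "h \<in> borel_measurable (borel \<Otimes>\<^sub>M borel)"
  shows integrable_lebesgue_pair_iff:
      "integrable (lebesgue \<Otimes>\<^sub>M lebesgue) h \<longleftrightarrow> integrable (lborel \<Otimes>\<^sub>M lborel) h"
    and integral_lebesgue_pair:
      "integral\<^sup>L (lebesgue \<Otimes>\<^sub>M lebesgue) h = integral\<^sup>L (lborel \<Otimes>\<^sub>M lborel) h"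
proof -
  have m: "(\<lambda>z. z) \<in> lebesgue \<Otimes>\<^sub>M lebesgue \<rightarrow>\<^sub>M (borel \<Otimes>\<^sub>M borel :: ('a \<times> 'a) measure)"
    by (rule measurable_pair_measureI)
      (auto simp: space_pair_measure)
  show "integrable (lebesgue \<Otimes>\<^sub>M lebesgue) h \<longleftrightarrow> integrable (lborel \<Otimes>\<^sub>M lborel) h"
    unfolding distr_lebesgue_pair[symmetric] by (subst integrable_distr_eq[OF m]) auto
  show "integral\<^sup>L (lebesgue \<Otimes>\<^sub>M lebesgue) h = integral\<^sup>L (lborel \<Otimes>\<^sub>M lborel) h"
    unfolding distr_lebesgue_pair[symmetric] by (subst integral_distr[OF m]) auto
qed

lemma AE_pair_lebesgue:
  assumes "AE x in lebesgue. P (x::'a::euclidean_space)"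
  shows "AE z in lebesgue \<Otimes>\<^sub>M lebesgue. P (fst z) \<and> P (snd z :: 'a)"
proof -
  interpret sigma_finite_measure "lebesgue :: 'a measure"
  proof
    \<comment> \<open>A countable cover by Borel sets of finite measure still works: completion does
      not change the measure of Borel sets.\<close>
    obtain A :: "'a set set" where "countable A" "A \<subseteq> sets lborel" "\<Union>A = space lborel"
        "\<forall>a\<in>A. emeasure lborel a \<noteq> \<infinity>"
      using lborel.sigma_finite_countable by blast
    then show "\<exists>A::'a set set. countable A \<and> A \<subseteq> sets lebesgue \<and> \<Union>A = space lebesgue \<and>
        (\<forall>a\<in>A. emeasure lebesgue a \<noteq> \<infinity>)"
      by (intro exI[of _ A]) auto
  qed
  obtain Z where Z0: "{x \<in> space lebesgue. \<not> P x} \<subseteq> Z" "emeasure lebesgue Z = 0" "Z \<in> sets lebesgue"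
    using assms by (rule AE_E)
  then have Z: "Z \<in> null_sets lebesgue" "{x. \<not> P x} \<subseteq> Z"
    by (auto simp del: emeasure_completion)
  have "AE z in lebesgue \<Otimes>\<^sub>M (lebesgue :: 'a measure). z \<notin> Z \<times> UNIV"
    by (rule AE_not_in, rule times_in_null_sets1[OF Z(1)]) simp
  moreover have "AE z in lebesgue \<Otimes>\<^sub>M (lebesgue :: 'a measure). z \<notin> UNIV \<times> Z"
    by (rule AE_not_in, rule times_in_null_sets2[OF _ Z(1)]) simp
  ultimately show ?thesis
  proof eventually_elim
    case (elim z)
    then have "fst z \<notin> Z" "snd z \<notin> Z" by (simp_all add: mem_Times_iff)
    then show ?case using Z(2) by blast
  qed
qed

lemma energy_density_measurable [measurable]:
  fixes u v :: "'a::euclidean_space \<Rightarrow> real"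
  assumes [measurable]: "u \<in> borel_measurable borel" "v \<in> borel_measurable borel"
  shows "energy_density s u v \<in> borel_measurable (borel \<Otimes>\<^sub>M borel)"
  unfolding energy_density_def by measurable

lemma frac_const_pos:
  assumes "0 < s" "s < 1"
  shows "0 < frac_const TYPE('a::euclidean_space) s"
  using assms unfolding frac_const_def
  by (intro divide_pos_pos mult_pos_pos Gamma_real_pos) auto

subsection \<open>Truncated dilations and translations\<close>

lemma abs_sin_diff_le: "\<bar>sin a - sin b\<bar> \<le> \<bar>a - b\<bar>" for a b :: real
proof -
  have "\<bar>sin a - sin b\<bar> = 2 * (\<bar>sin ((a - b) / 2)\<bar> * \<bar>cos ((a + b) / 2)\<bar>)"
    by (simp add: sin_diff_sin abs_mult)
  also have "\<dots> \<le> 2 * (\<bar>(a - b) / 2\<bar> * 1)"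
    by (intro mult_left_mono mult_mono abs_sin_x_le_abs_x) auto
  finally show ?thesis by simp
qed

text \<open>The deformations below act on each coordinate separately, so Lipschitz bounds in one
  variable carry over to the norm with the same constant.\<close>

lemma norm_le_componentwise_mult:
  fixes x y :: "'a::euclidean_space"
  assumes "0 \<le> c" "\<And>b. b \<in> Basis \<Longrightarrow> \<bar>x \<bullet> b\<bar> \<le> c * \<bar>y \<bullet> b\<bar>"
  shows "norm x \<le> c * norm y"
proof -
  have "norm x = L2_set (\<lambda>b. \<bar>x \<bullet> b\<bar>) Basis"
    by (simp add: norm_eq_sqrt_inner euclidean_inner[of _ x] L2_set_def power2_eq_square)
  also have "\<dots> \<le> L2_set (\<lambda>b. c * \<bar>y \<bullet> b\<bar>) Basis"
    using assms(2) by (intro L2_set_mono) auto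
  also have "\<dots> = c * L2_set (\<lambda>b. \<bar>y \<bullet> b\<bar>) Basis"
    by (simp add: L2_set_right_distrib assms(1))
  also have "L2_set (\<lambda>b. \<bar>y \<bullet> b\<bar>) Basis = norm y"
    by (simp add: norm_eq_sqrt_inner euclidean_inner[of _ y] L2_set_def power2_eq_square)
  finally show ?thesis .
qed

text \<open>One locale covers both deformations: \<open>t = 0\<close> is translation by
  \<open>h\<close>, and \<open>h = 0\<close> is the truncated dilation. The bound on
  \<open>t\<close> keeps the derivative of each coordinate map, \<open>1 + t * cos (r / R)\<close>,
  between 1/2 and 3/2, so that \<open>map\<close> is bi-Lipschitz and onto.\<close>

locale warp =
  fixes h :: "'a::euclidean_space" and t R :: real
  assumes R_pos: "0 < R" and t_le: "\<bar>t\<bar> \<le> 1 / 2"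
begin

definition coord :: "'a \<Rightarrow> real \<Rightarrow> real" where
  "coord b r = r + h \<bullet> b + t * R * sin (r / R)"

definition map :: "'a \<Rightarrow> 'a" where
  "map x = (\<Sum>b\<in>Basis. coord b (x \<bullet> b) *\<^sub>R b)"

definition jac :: "'a \<Rightarrow> real" where
  "jac x = (\<Prod>b\<in>Basis. 1 + t * cos ((x \<bullet> b) / R))"

definition inv_map :: "'a \<Rightarrow> 'a" where
  "inv_map = inv map"

text \<open>The Jacobian determinant of \<open>inv_map\<close>, hence the density of the image of
  Lebesgue measure under \<open>map\<close>; see \<open>distr_map\<close>.\<close>

definition inv_jac :: "'a \<Rightarrow> real" where
  "inv_jac y = 1 / jac (inv_map y)"

lemma map_inner [simp]: "b \<in> Basis \<Longrightarrow> map x \<bullet> b = coord b (x \<bullet> b)"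
  by (simp add: map_def)

lemma sin_scaled_diff_le: "\<bar>R * sin (r / R) - R * sin (r' / R)\<bar> \<le> \<bar>r - r'\<bar>"
proof -
  have "\<bar>R * sin (r / R) - R * sin (r' / R)\<bar> = R * \<bar>sin (r / R) - sin (r' / R)\<bar>"
    using R_pos by (simp add: abs_mult flip: right_diff_distrib)
  also have "\<dots> \<le> R * \<bar>r / R - r' / R\<bar>"
    using R_pos by (intro mult_left_mono abs_sin_diff_le) auto
  also have "\<dots> = \<bar>r - r'\<bar>"
    using R_pos by (simp add: abs_divide flip: diff_divide_distrib)
  finally show ?thesis .
qed

lemma coord_diff:
  "coord b r - coord b r' = (r - r') + t * (R * sin (r / R) - R * sin (r' / R))"
  by (simp add: coord_def algebra_simps)

lemma sin_part_le: "\<bar>t * (R * sin (r / R) - R * sin (r' / R))\<bar> \<le> \<bar>r - r'\<bar> / 2"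
proof -
  have "\<bar>t * (R * sin (r / R) - R * sin (r' / R))\<bar> \<le> 1 / 2 * \<bar>r - r'\<bar>"
    unfolding abs_mult[of t] by (intro mult_mono t_le sin_scaled_diff_le) auto
  then show ?thesis by simp
qed

text \<open>\<open>coord b\<close> is the identity plus a constant and a perturbation with Lipschitz
  constant 1/2, so a difference changes by at most half of its size.\<close>

lemma coord_lower: "\<bar>r - r'\<bar> \<le> 2 * \<bar>coord b r - coord b r'\<bar>"
  and coord_upper: "\<bar>coord b r - coord b r'\<bar> \<le> 2 * \<bar>r - r'\<bar>"
  and coord_strict_mono: "r < r' \<Longrightarrow> coord b r < coord b r'"
proof -
  obtain z where z: "coord b r - coord b r' = (r - r') + z" "\<bar>z\<bar> \<le> \<bar>r - r'\<bar> / 2"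
    using coord_diff sin_part_le by blast
  have *: "\<bar>d\<bar> \<le> 2 * \<bar>e\<bar> \<and> \<bar>e\<bar> \<le> 2 * \<bar>d\<bar> \<and> (d < 0 \<longrightarrow> e < 0)"
    if "e = d + z" "\<bar>z\<bar> \<le> \<bar>d\<bar> / 2" for d e z :: real
    using that by (intro conjI impI; linarith)
  from *[OF z] show "\<bar>r - r'\<bar> \<le> 2 * \<bar>coord b r - coord b r'\<bar>"
    "\<bar>coord b r - coord b r'\<bar> \<le> 2 * \<bar>r - r'\<bar>"
    "r < r' \<Longrightarrow> coord b r < coord b r'"
    by auto
qed

lemma map_lower: "norm (x - y) \<le> 2 * norm (map x - map y)"
  by (rule norm_le_componentwise_mult) (simp_all add: inner_diff_left coord_lower)

lemma map_upper: "norm (map x - map y) \<le> 2 * norm (x - y)"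
  by (rule norm_le_componentwise_mult) (simp_all add: inner_diff_left coord_upper)

lemma coord_less_iff: "coord b r < coord b r' \<longleftrightarrow> r < r'"
  using coord_strict_mono[of r r' b] coord_strict_mono[of r' r b]
  by (cases r r' rule: linorder_cases) auto

lemma coord_deriv: "(coord b has_real_derivative (1 + t * cos (r / R))) (at r)"
proof -
  have "((\<lambda>r. r + h \<bullet> b + t * R * sin (r / R)) has_real_derivative
      (1 + t * cos (r / R))) (at r)"
    using R_pos by (auto intro!: derivative_eq_intros)
  then show ?thesis by (simp add: coord_def[abs_def])
qed

lemma continuous_coord [continuous_intros]: "continuous_on A (coord b)"
  by (auto intro!: continuous_at_imp_continuous_on DERIV_isCont[OF coord_deriv])

lemma coord_surj: "\<exists>r. coord b r = c"
proof -
  \<comment> \<open>\<open>coord b\<close> moves every point by at most \<open>D\<close>, so its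
    values at \<open>c - D\<close> and \<open>c + D\<close> enclose \<open>c\<close>.\<close>
  define D where "D = \<bar>h \<bullet> b\<bar> + R"
  have est: "\<bar>coord b r - r\<bar> \<le> D" for r
  proof -
    have "\<bar>t * R * sin (r / R)\<bar> \<le> 1 * R * 1"
      unfolding abs_mult using R_pos t_le by (intro mult_mono) auto
    then show ?thesis by (simp add: coord_def D_def)
  qed
  have "\<exists>r. c - D \<le> r \<and> r \<le> c + D \<and> coord b r = c"
  proof (rule IVT')
    show "coord b (c - D) \<le> c" using est[of "c - D"] by linarith
    show "c \<le> coord b (c + D)" using est[of "c + D"] by linarith
    show "c - D \<le> c + D" using R_pos by (simp add: D_def)
  qed (rule continuous_coord)
  then show ?thesis by blast
qed

lemma inj_map: "inj map"
proof
  fix x y assume "map x = map y"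
  then show "x = y" using map_lower[of x y] by simp
qed

lemma surj_map: "surj map"
proof -
  have "\<exists>x. y = map x" for y
  proof -
    have "\<forall>b. \<exists>r. coord b r = y \<bullet> b" using coord_surj by blast
    then obtain r where r: "\<And>b. coord b (r b) = y \<bullet> b" by metis
    have "y = map (\<Sum>b\<in>Basis. r b *\<^sub>R b)"
      by (rule euclidean_eqI) (simp add: r)
    then show ?thesis ..
  qed
  then show ?thesis by auto
qed

lemma map_inv_map [simp]: "map (inv_map y) = y"
  unfolding inv_map_def by (rule surj_f_inv_f[OF surj_map])

lemma inv_map_map [simp]: "inv_map (map x) = x"
  unfolding inv_map_def by (rule inv_f_f[OF inj_map])

lemma inv_map_lower: "norm (x - y) \<le> 2 * norm (inv_map x - inv_map y)"
  and inv_map_upper: "norm (inv_map x - inv_map y) \<le> 2 * norm (x - y)"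
  using map_upper[of "inv_map x" "inv_map y"] map_lower[of "inv_map x" "inv_map y"] by auto

lemma continuous_map: "continuous_on UNIV map"
  unfolding map_def[abs_def]
  by (intro continuous_intros continuous_on_compose2[OF continuous_coord[of UNIV]]) auto

lemma continuous_inv_map: "continuous_on UNIV inv_map"
proof (rule lipschitz_on_continuous_on)
  show "2-lipschitz_on UNIV inv_map"
    by (rule lipschitz_onI) (use inv_map_upper in \<open>auto simp: dist_norm\<close>)
qed

lemma map_measurable [measurable]: "map \<in> borel_measurable borel"
  and inv_map_measurable [measurable]: "inv_map \<in> borel_measurable borel"
  using continuous_map continuous_inv_map by (auto intro: borel_measurable_continuous_onI)

lemma jac_measurable [measurable]: "jac \<in> borel_measurable borel"
  unfolding jac_def[abs_def] by measurable

lemma inv_jac_measurable [measurable]: "inv_jac \<in> borel_measurable borel"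
  unfolding inv_jac_def[abs_def] by measurable

lemma jac_factor: "1 / 2 \<le> 1 + t * cos r" "1 + t * cos r \<le> 2" "0 \<le> 1 + t * cos r"
proof -
  have "\<bar>t * cos r\<bar> \<le> 1 / 2 * 1"
    unfolding abs_mult using t_le by (intro mult_mono) auto
  then have "1 / 2 \<le> 1 + t * cos r \<and> 1 + t * cos r \<le> 2" by linarith
  then show "1 / 2 \<le> 1 + t * cos r" "1 + t * cos r \<le> 2" "0 \<le> 1 + t * cos r" by auto
qed

lemma jac_lower: "(1 / 2) ^ DIM('a) \<le> jac x"
  and jac_upper: "jac x \<le> 2 ^ DIM('a)"
proof -
  have "(\<Prod>b\<in>(Basis::'a set). 1 / 2) \<le> jac x"
    unfolding jac_def by (intro prod_mono) (use jac_factor in auto)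
  then show "(1 / 2) ^ DIM('a) \<le> jac x" by simp
  have "jac x \<le> (\<Prod>b\<in>(Basis::'a set). 2)"
    unfolding jac_def by (intro prod_mono) (use jac_factor in auto)
  then show "jac x \<le> 2 ^ DIM('a)" by simp
qed

lemma jac_pos: "0 < jac x"
  by (rule less_le_trans[OF _ jac_lower]) simp

lemma inv_jac_pos: "0 < inv_jac y"
  by (simp add: inv_jac_def jac_pos)

lemma inv_jac_lower: "(1 / 2) ^ DIM('a) \<le> inv_jac y"
  and inv_jac_upper: "inv_jac y \<le> 2 ^ DIM('a)"
  using jac_upper[of "inv_map y"] jac_lower[of "inv_map y"] jac_pos[of "inv_map y"]
  by (auto simp: inv_jac_def field_simps power_divide)

section \<open>Change of variables under a warp\<close>

lemma nn_integral_coord_interval: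
  assumes "l \<le> u"
  shows "(\<integral>\<^sup>+ r. ennreal (1 + t * cos (r / R)) * indicator {l<..<u} (coord b r) \<partial>lborel) = ennreal (u - l)"
proof -
  obtain a c where ac: "coord b a = l" "coord b c = u" using coord_surj by metis
  have "a \<le> c" using assms coord_less_iff[of b c a] ac by auto
  have "(\<integral>\<^sup>+ r. ennreal (1 + t * cos (r / R)) * indicator {l<..<u} (coord b r) \<partial>lborel) =
     (\<integral>\<^sup>+ r. ennreal (1 + t * cos (r / R)) * indicator {a..c} r \<partial>lborel)"
  proof (rule nn_integral_cong_AE)
    show "AE r in lborel. ennreal (1 + t * cos (r / R)) * indicator {l<..<u} (coord b r) =
        ennreal (1 + t * cos (r / R)) * indicator {a..c} r"
      \<comment> \<open>The preimage of the open interval is the open interval from \<open>a\<close>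
        to \<open>c\<close>; the closed one adds only the endpoints, a null set.\<close>
      using AE_lborel_singleton[of a] AE_lborel_singleton[of c]
      by eventually_elim
        (use coord_less_iff[of b] in \<open>auto simp: ac[symmetric] indicator_def\<close>)
  qed
  also have "\<dots> = ennreal (coord b c - coord b a)"
  proof (rule nn_integral_FTC_Icc)
    show "0 \<le> 1 + t * cos (x / R)" for x using jac_factor(1)[of "x / R"] by simp
  qed (use coord_deriv \<open>a \<le> c\<close> in \<open>auto intro: has_field_derivative_at_within\<close>)
  finally show ?thesis by (simp add: ac)
qed

text \<open>It suffices to measure boxes. The preimage of a box is cut out by conditions on single
  coordinates and \<open>jac\<close> is a product over coordinates, so Tonelli reduces the claim to
  \<open>nn_integral_coord_interval\<close>.\<close>

lemma distr_density_jac: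
  "distr (density lborel (\<lambda>x. ennreal (jac x))) borel map = lborel"
proof (rule lborel_eqI[symmetric])
  fix l u :: 'a assume lu: "\<And>b. b \<in> Basis \<Longrightarrow> l \<bullet> b \<le> u \<bullet> b"
  have m: "map -` box l u \<in> sets borel"
    using measurable_sets[OF map_measurable, of "box l u"] by simp
  have "emeasure (distr (density lborel (\<lambda>x. ennreal (jac x))) borel map) (box l u) =
     (\<integral>\<^sup>+ x. ennreal (jac x) * indicator (map -` box l u) x \<partial>lborel)"
    using m by (simp add: emeasure_distr emeasure_density)
  also have "\<dots> = (\<integral>\<^sup>+ x. (\<Prod>b\<in>Basis. ennreal (1 + t * cos ((x \<bullet> b) / R)) *
       indicator {l \<bullet> b<..<u \<bullet> b} (coord b (x \<bullet> b))) \<partial>lborel)"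
  proof (rule nn_integral_cong)
    fix x :: 'a
    have "indicator (map -` box l u) x =
        (\<Prod>b\<in>Basis. indicator {l \<bullet> b<..<u \<bullet> b} (coord b (x \<bullet> b)) :: ennreal)"
      by (auto simp: indicator_def mem_box prod_zero_iff)
    moreover have "ennreal (jac x) = (\<Prod>b\<in>Basis. ennreal (1 + t * cos ((x \<bullet> b) / R)))"
      unfolding jac_def by (subst prod_ennreal) (use jac_factor in auto)
    ultimately show "ennreal (jac x) * indicator (map -` box l u) x =
        (\<Prod>b\<in>Basis. ennreal (1 + t * cos ((x \<bullet> b) / R)) *
          indicator {l \<bullet> b<..<u \<bullet> b} (coord b (x \<bullet> b)))"
      by (simp add: prod.distrib)
  qed
  also have "\<dots> = (\<Prod>b\<in>Basis. (\<integral>\<^sup>+ r. ennreal (1 + t * cos (r / R)) *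
       indicator {l \<bullet> b<..<u \<bullet> b} (coord b r) \<partial>lborel))"
  proof (rule nn_integral_lborel_prod)
    fix b :: 'a
    have [measurable]: "coord b \<in> borel_measurable borel"
      by (intro borel_measurable_continuous_onI continuous_coord)
    show "(\<lambda>r. ennreal (1 + t * cos (r / R)) * indicator {l \<bullet> b<..<u \<bullet> b} (coord b r)) \<in> borel_measurable borel"
      by measurable
  qed auto
  also have "\<dots> = (\<Prod>b\<in>Basis. ennreal ((u - l) \<bullet> b))"
    by (intro prod.cong refl) (simp add: nn_integral_coord_interval lu inner_diff_left)
  also have "\<dots> = ennreal (\<Prod>b\<in>Basis. (u - l) \<bullet> b)"
    by (rule prod_ennreal) (simp add: lu inner_diff_left)
  finally show "emeasure (distr (density lborel (\<lambda>x. ennreal (jac x))) borel map) (box l u) =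
    ennreal (\<Prod>b\<in>Basis. (u - l) \<bullet> b)" .
qed simp

text \<open>Since \<open>inv_jac (map x)\<close> is the reciprocal of \<open>jac x\<close>,
  multiplying the preceding formula by it cancels the density.\<close>

lemma distr_map: "distr lborel borel map = density lborel (\<lambda>y. ennreal (inv_jac y))"
proof -
  have "density lborel (\<lambda>y. ennreal (inv_jac y)) =
      density (distr (density lborel (\<lambda>x. ennreal (jac x))) borel map) (\<lambda>y. ennreal (inv_jac y))"
    by (simp only: distr_density_jac)
  also have "\<dots> = distr (density (density lborel (\<lambda>x. ennreal (jac x))) (\<lambda>x. ennreal (inv_jac (map x)))) borel map"
    by (rule density_distr) auto
  also have "density (density lborel (\<lambda>x. ennreal (jac x))) (\<lambda>x. ennreal (inv_jac (map x))) = lborel"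
  proof -
    have "ennreal (jac x) * ennreal (inv_jac (map x)) = 1" for x
      using jac_pos[of x] by (simp add: inv_jac_def flip: ennreal_mult)
    then show ?thesis by (simp add: density_density_eq density_1)
  qed
  finally show ?thesis by simp
qed

lemma sigma_finite_density_inv_jac: "sigma_finite_measure (density lborel (\<lambda>y. ennreal (inv_jac y)))"
  by (subst sigma_finite_measure.sigma_finite_iff_density_finite[OF sigma_finite_lborel]) auto

lemma distr_map_pair:
  "distr (lborel \<Otimes>\<^sub>M lborel) (borel \<Otimes>\<^sub>M borel) (\<lambda>z. (map (fst z), map (snd z))) =
    density (lborel \<Otimes>\<^sub>M lborel) (\<lambda>z. ennreal (inv_jac (fst z) * inv_jac (snd z)))"
proof -
  have "distr lborel borel map \<Otimes>\<^sub>M distr lborel borel map =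
    distr (lborel \<Otimes>\<^sub>M lborel) (borel \<Otimes>\<^sub>M borel) (\<lambda>(x, y). (map x, map y))"
    by (rule pair_measure_distr) (auto simp: distr_map sigma_finite_density_inv_jac)
  moreover have "density lborel (\<lambda>y. ennreal (inv_jac y)) \<Otimes>\<^sub>M density lborel (\<lambda>y. ennreal (inv_jac y)) =
    density (lborel \<Otimes>\<^sub>M lborel) (\<lambda>(x, y). ennreal (inv_jac x) * ennreal (inv_jac y))"
    by (rule pair_measure_density) (auto simp: sigma_finite_density_inv_jac sigma_finite_lborel)
  ultimately show ?thesis
    by (simp add: distr_map split_beta' ennreal_mult inv_jac_pos less_imp_le)
qed

text \<open>The truncation by the sine serves this estimate: unlike a dilation, which moves far
  points far, it gives a bound uniform in \<open>x\<close>.\<close>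

lemma map_displacement: "norm (map x - x) \<le> norm h + DIM('a) * (\<bar>t\<bar> * R)"
proof -
  have "map x - x = h + (\<Sum>b\<in>Basis. (t * R * sin (x \<bullet> b / R)) *\<^sub>R b)"
    by (rule euclidean_eqI) (simp add: inner_diff_left inner_add_left coord_def inner_sum_left_Basis)
  also have "norm \<dots> \<le> norm h + (\<Sum>b\<in>(Basis::'a set). \<bar>t\<bar> * R)"
  proof (intro norm_triangle_mono order_refl sum_norm_le)
    fix b :: 'a assume "b \<in> Basis"
    then show "norm ((t * R * sin (x \<bullet> b / R)) *\<^sub>R b) \<le> \<bar>t\<bar> * R"
      using R_pos by (auto simp: abs_mult intro!: mult_left_le)
  qed
  finally show ?thesis by simp
qed

end

subsection \<open>Composition of test functions with a warp\<close>

lemma C_class_SucI: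
  assumes "\<And>x. (g has_derivative g' x) (at x)" "\<And>v. C_class k (\<lambda>x. g' x v)"
  shows "C_class (Suc k) g"
proof -
  have "frechet_derivative g (at x) = g' x" for x
    using frechet_derivative_at[OF assms(1)] by metis
  then show ?thesis
    using assms by (auto simp: differentiable_def)
qed

lemma C_class_SucD:
  assumes "C_class (Suc k) g"
  shows "(g has_derivative frechet_derivative g (at x)) (at x)"
    and "C_class k (\<lambda>x. frechet_derivative g (at x) v)"
  using assms by (auto simp: frechet_derivative_works)

lemma C_class_Suc_imp: "C_class (Suc k) g \<Longrightarrow> C_class k g"
proof (induction k arbitrary: g)
  case 0
  then show ?case
    by (auto intro!: continuous_at_imp_continuous_on differentiable_imp_continuous_within)
next
  case (Suc k)
  then show ?case by (auto intro: C_class_SucI dest: C_class_SucD)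
qed

lemma C_class_const: "C_class k (\<lambda>x. c)"
  by (induction k arbitrary: c) (auto intro!: C_class_SucI derivative_eq_intros)

lemma C_class_add:
  "C_class k f \<Longrightarrow> C_class k g \<Longrightarrow> C_class k (\<lambda>x. f x + g x)"
proof (induction k arbitrary: f g)
  case 0
  then show ?case by (auto intro: continuous_intros)
next
  case (Suc k)
  show ?case
    by (rule C_class_SucI[OF has_derivative_add[OF C_class_SucD(1)[OF Suc.prems(1)] C_class_SucD(1)[OF Suc.prems(2)]]])
      (intro Suc.IH C_class_SucD(2)[OF Suc.prems(1)] C_class_SucD(2)[OF Suc.prems(2)])
qed

lemma C_class_sum:
  "finite A \<Longrightarrow> (\<And>i. i \<in> A \<Longrightarrow> C_class k (f i)) \<Longrightarrow> C_class k (\<lambda>x. \<Sum>i\<in>A. f i x)"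
  by (induction A rule: finite_induct) (auto intro: C_class_const C_class_add)

lemma C_class_mult:
  fixes f g :: "'a::real_normed_vector \<Rightarrow> real"
  shows "C_class k f \<Longrightarrow> C_class k g \<Longrightarrow> C_class k (\<lambda>x. f x * g x)"
proof (induction k arbitrary: f g)
  case 0
  then show ?case by (auto intro: continuous_intros)
next
  case (Suc k)
  show ?case
    by (rule C_class_SucI[OF has_derivative_mult[OF C_class_SucD(1)[OF Suc.prems(1)] C_class_SucD(1)[OF Suc.prems(2)]]])
      (intro C_class_add Suc.IH C_class_SucD(2)[OF Suc.prems(1)] C_class_SucD(2)[OF Suc.prems(2)]
        C_class_Suc_imp[OF Suc.prems(1)] C_class_Suc_imp[OF Suc.prems(2)])
qed

text \<open>The phase \<open>\<delta>\<close> closes the induction: differentiating shifts it by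
  \<open>pi / 2\<close> and produces a function of the same shape.\<close>

lemma C_class_cos: "C_class k (\<lambda>x::'a::real_inner. \<alpha> + \<beta> * cos (x \<bullet> c + \<delta>))"
proof (induction k arbitrary: \<alpha> \<beta> \<delta>)
  case 0
  show ?case by (auto intro!: continuous_intros)
next
  case (Suc k)
  have "((\<lambda>x. \<alpha> + \<beta> * cos (x \<bullet> c + \<delta>)) has_derivative
      (\<lambda>v. 0 + (\<beta> * (v \<bullet> c)) * cos (x \<bullet> c + (\<delta> + pi / 2)))) (at x)" for x
    by (auto intro!: derivative_eq_intros ext simp: cos_add sin_add algebra_simps)
  then show ?case
    by (rule C_class_SucI) (rule Suc.IH)
qed

context warp
begin

lemma map_has_derivative:
  "(map has_derivative (\<lambda>v. \<Sum>b\<in>Basis. ((1 + t * cos ((x \<bullet> b) / R)) * (v \<bullet> b)) *\<^sub>R b)) (at x)"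
proof -
  have "((\<lambda>x. coord b (x \<bullet> b)) has_derivative (\<lambda>v. (1 + t * cos ((x \<bullet> b) / R)) * (v \<bullet> b))) (at x)" for b
    by (rule has_derivative_compose[OF bounded_linear_imp_has_derivative[OF bounded_linear_inner_left]
        coord_deriv[unfolded has_field_derivative_def]])
  then show ?thesis
    unfolding map_def[abs_def] by (intro has_derivative_sum has_derivative_scaleR_left)
qed

text \<open>By the chain rule a derivative of the composition is a sum of products of cosines,
  constants and partial derivatives of \<open>\<phi>\<close> composed with \<open>map\<close>. The
  last are covered by the induction hypothesis, since the induction is over all
  \<open>\<phi>\<close>.\<close>

lemma C_class_comp_map:
  "(\<And>j. C_class j \<phi>) \<Longrightarrow> C_class k (\<lambda>x. \<phi> (map x) :: real)"
proof (induction k arbitrary: \<phi>)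
  case 0
  have "continuous_on UNIV \<phi>" using 0[of 0] by simp
  then show ?case
    using continuous_on_compose2[OF _ continuous_map, of UNIV \<phi>] by auto
next
  case (Suc k)
  define D where "D b x = frechet_derivative \<phi> (at x) b" for b x
  have D: "C_class j (D b)" for j b
    using C_class_SucD(2)[OF Suc.prems, where v = b] by (simp add: D_def[abs_def])
  \<comment> \<open>The cosine is written as in \<open>C_class_cos\<close>, with phase 0 and
    direction \<open>b / R\<close>.\<close>
  have der: "((\<lambda>x. \<phi> (map x)) has_derivative
      (\<lambda>v. \<Sum>b\<in>Basis. (1 + t * cos (x \<bullet> ((1 / R) *\<^sub>R b) + 0)) * ((v \<bullet> b) * D b (map x)))) (at x)" for x
  proof -
    have lin: "linear (frechet_derivative \<phi> (at (map x)))"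
      using C_class_SucD(1)[OF Suc.prems] has_derivative_linear by blast
    have "((\<lambda>x. \<phi> (map x)) has_derivative
      (\<lambda>v. frechet_derivative \<phi> (at (map x)) (\<Sum>b\<in>Basis. ((1 + t * cos ((x \<bullet> b) / R)) * (v \<bullet> b)) *\<^sub>R b))) (at x)"
      by (rule has_derivative_compose[OF map_has_derivative C_class_SucD(1)[OF Suc.prems]])
    also have "(\<lambda>v. frechet_derivative \<phi> (at (map x)) (\<Sum>b\<in>Basis. ((1 + t * cos ((x \<bullet> b) / R)) * (v \<bullet> b)) *\<^sub>R b)) =
      (\<lambda>v. \<Sum>b\<in>Basis. (1 + t * cos (x \<bullet> ((1 / R) *\<^sub>R b) + 0)) * ((v \<bullet> b) * D b (map x)))"
      by (simp add: linear_sum[OF lin] linear_cmul[OF lin] D_def mult.assoc)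
    finally show ?thesis .
  qed
  show ?case
  proof (rule C_class_SucI[OF der])
    fix v
    show "C_class k (\<lambda>x. \<Sum>b\<in>Basis. (1 + t * cos (x \<bullet> ((1 / R) *\<^sub>R b) + 0)) * ((v \<bullet> b) * D b (map x)))"
      by (intro C_class_sum finite_Basis C_class_mult C_class_cos C_class_const Suc.IH D)
  qed
qed

text \<open>The bounded displacement of \<open>map\<close> keeps the support bounded.\<close>

lemma test_function_comp_map:
  assumes "test_function \<phi>"
  shows "test_function (\<lambda>x. \<phi> (map x))"
proof -
  have "bounded (support_on UNIV \<phi>)"
    using assms compact_imp_bounded bounded_subset[OF _ closure_subset]
    by (auto simp: test_function_def)
  then obtain B where B: "\<And>x. \<phi> x \<noteq> 0 \<Longrightarrow> norm x \<le> B"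
    by (auto simp: bounded_iff support_on_def)
  have "norm x \<le> B + (norm h + DIM('a) * (\<bar>t\<bar> * R))" if "\<phi> (map x) \<noteq> 0" for x
    using B[OF that] map_displacement[of x] norm_triangle_ineq2[of x "map x"]
    by (simp add: norm_minus_commute)
  then have "bounded (support_on UNIV (\<lambda>x. \<phi> (map x)))"
    by (auto simp: bounded_iff support_on_def)
  then show ?thesis
    using assms C_class_comp_map[of \<phi>] by (auto simp: test_function_def compact_closure)
qed

end

subsection \<open>Energies under a change of variables\<close>

lemma energy_density_nonneg: "0 \<le> energy_density s v v z"
  by (auto simp: energy_density_def split: prod.splits)

lemma energy_form_borel:
  fixes v w :: "'a::euclidean_space \<Rightarrow> real"
  assumes "v \<in> borel_measurable borel" "w \<in> borel_measurable borel"
  shows "energy_form s v w =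
    frac_const TYPE('a) s / 2 * (LINT z|(lborel \<Otimes>\<^sub>M lborel). energy_density s v w z)"
  using assms by (simp add: energy_form_def integral_lebesgue_pair)

lemma test_function_measurable: "test_function \<phi> \<Longrightarrow> \<phi> \<in> borel_measurable borel"
  unfolding test_function_def
  by (auto intro!: borel_measurable_continuous_onI dest: spec[of _ 0])

context warp
begin

text \<open>Substituting \<open>map\<close> in both variables turns the energy of
  \<open>v \<circ> map\<close> into the integral of the energy density of \<open>v\<close> times
  this weight, so the dependence on the deformation does not involve the regularity of
  \<open>v\<close>. On the diagonal the weight is 0, as \<open>0 / 0 = 0\<close>.\<close>

definition kernel_weight :: "real \<Rightarrow> 'a \<times> 'a \<Rightarrow> real" where
  "kernel_weight p = (\<lambda>(x, y). inv_jac x * inv_jac y *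
     (norm (x - y) / norm (inv_map x - inv_map y)) powr p)"

lemma kernel_weight_measurable [measurable]:
  "kernel_weight p \<in> borel_measurable (borel \<Otimes>\<^sub>M borel)"
  unfolding kernel_weight_def by measurable

lemma kernel_weight_upper:
  assumes "0 \<le> p"
  shows "kernel_weight p z \<le> 2 ^ DIM('a) * 2 ^ DIM('a) * 2 powr p"
proof -
  obtain x y where z: "z = (x, y)" by force
  have "norm (x - y) / norm (inv_map x - inv_map y) \<le> 2"
    using inv_map_lower[of x y] by (cases "inv_map x - inv_map y = 0") (auto simp: field_simps)
  then have "(norm (x - y) / norm (inv_map x - inv_map y)) powr p \<le> 2 powr p"
    using assms by (intro powr_mono2) auto
  then show ?thesis
    unfolding z kernel_weight_def prod.case
    using inv_jac_upper inv_jac_pos by (intro mult_mono) (auto simp: less_imp_le)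
qed

lemma kernel_weight_lower:
  assumes "0 \<le> p" "x \<noteq> y"
  shows "(1 / 2) ^ DIM('a) * (1 / 2) ^ DIM('a) * (1 / 2) powr p \<le> kernel_weight p (x, y)"
proof -
  have "inv_map x \<noteq> inv_map y" using assms(2) map_inv_map by metis
  then have "1 / 2 \<le> norm (x - y) / norm (inv_map x - inv_map y)"
    using inv_map_upper[of x y] by (auto simp: field_simps)
  then have "(1 / 2) powr p \<le> (norm (x - y) / norm (inv_map x - inv_map y)) powr p"
    using assms by (intro powr_mono2) auto
  then show ?thesis
    unfolding kernel_weight_def prod.case
    using inv_jac_lower inv_jac_pos by (intro mult_mono) (auto simp: less_imp_le)
qed

lemma integrable_energy_comp_iff:
    "integrable (lborel \<Otimes>\<^sub>M lborel) (energy_density s (\<lambda>x. v (map x)) (\<lambda>x. w (map x))) \<longleftrightarrow>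
      integrable (lborel \<Otimes>\<^sub>M lborel)
        (\<lambda>z. kernel_weight (real DIM('a) + 2 * s) z * energy_density s v w z)" (is ?A)
  and integral_energy_comp:
    "(LINT z|(lborel \<Otimes>\<^sub>M lborel). energy_density s (\<lambda>x. v (map x)) (\<lambda>x. w (map x)) z) =
      (LINT z|(lborel \<Otimes>\<^sub>M lborel). kernel_weight (real DIM('a) + 2 * s) z * energy_density s v w z)"
      (is ?B)
  if [measurable]: "v \<in> borel_measurable borel" "w \<in> borel_measurable borel"
proof -
  let ?p = "real DIM('a) + 2 * s"
  let ?L = "lborel \<Otimes>\<^sub>M lborel :: ('a \<times> 'a) measure"
  \<comment> \<open>\<open>G\<close> is chosen so that composing it with \<open>map\<close> in both
    variables gives the energy density of the compositions: the quotient of norms replaces the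
    distance of the images by that of the points themselves.\<close>
  define G where "G z = (norm (fst z - snd z) / norm (inv_map (fst z) - inv_map (snd z))) powr ?p *
    energy_density s v w z" for z
  have [measurable]: "G \<in> borel_measurable (borel \<Otimes>\<^sub>M borel)"
    unfolding G_def[abs_def] by measurable
  have comp: "energy_density s (\<lambda>x. v (map x)) (\<lambda>x. w (map x)) z = G (map (fst z), map (snd z))" for z
  proof (cases "fst z = snd z")
    case True
    then show ?thesis by (cases z) (simp add: energy_density_def G_def)
  next
    case False
    then have "map (fst z) \<noteq> map (snd z)" using inj_map by (auto dest: injD)
    then show ?thesis
      by (cases z) (simp add: energy_density_def G_def powr_divide)
  qed
  have m: "(\<lambda>z. (map (fst z), map (snd z))) \<in> ?L \<rightarrow>\<^sub>M (borel \<Otimes>\<^sub>M borel)"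
    by measurable
  have w: "kernel_weight ?p z * energy_density s v w z = (inv_jac (fst z) * inv_jac (snd z)) *\<^sub>R G z" for z
    by (cases z) (simp add: kernel_weight_def G_def)
  have "integrable ?L (\<lambda>z. G (map (fst z), map (snd z))) \<longleftrightarrow>
      integrable (density ?L (\<lambda>z. ennreal (inv_jac (fst z) * inv_jac (snd z)))) G"
    unfolding distr_map_pair[symmetric] by (subst integrable_distr_eq[OF m]) simp_all
  also have "\<dots> \<longleftrightarrow> integrable ?L (\<lambda>z. (inv_jac (fst z) * inv_jac (snd z)) *\<^sub>R G z)"
    by (rule integrable_density) (auto simp: inv_jac_pos less_imp_le)
  finally show ?A unfolding comp[abs_def] w .
  have "(LINT z|?L. G (map (fst z), map (snd z))) =
      (LINT z|density ?L (\<lambda>z. ennreal (inv_jac (fst z) * inv_jac (snd z))). G z)"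
    unfolding distr_map_pair[symmetric] by (subst integral_distr[OF m]) simp_all
  also have "\<dots> = (LINT z|?L. (inv_jac (fst z) * inv_jac (snd z)) *\<^sub>R G z)"
    by (rule integral_density) (auto simp: inv_jac_pos less_imp_le)
  finally show ?B unfolding comp w .
qed

lemma integrable_comp_map_iff:
    "integrable lborel (\<lambda>x. g (map x)) \<longleftrightarrow> integrable lborel (\<lambda>x. inv_jac x * g x)" (is ?A)
  and integral_comp_map:
    "(LINT x|lborel. g (map x)) = (LINT x|lborel. inv_jac x * g x)" (is ?B)
  if [measurable]: "g \<in> borel_measurable borel" for g :: "'a \<Rightarrow> real"
proof -
  have "integrable lborel (\<lambda>x. g (map x)) \<longleftrightarrow> integrable (density lborel (\<lambda>y. ennreal (inv_jac y))) g"
    unfolding distr_map[symmetric] by (subst integrable_distr_eq) simp_all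
  also have "\<dots> \<longleftrightarrow> integrable lborel (\<lambda>x. inv_jac x *\<^sub>R g x)"
    by (rule integrable_density) (auto simp: inv_jac_pos less_imp_le)
  finally show ?A by simp
  have "(LINT x|lborel. g (map x)) = (LINT x|density lborel (\<lambda>y. ennreal (inv_jac y)). g x)"
    unfolding distr_map[symmetric] by (subst integral_distr) simp_all
  also have "\<dots> = (LINT x|lborel. inv_jac x *\<^sub>R g x)"
    by (rule integral_density) (auto simp: inv_jac_pos less_imp_le)
  finally show ?B by simp
qed

lemma nn_integral_comp_map:
  assumes [measurable]: "g \<in> borel_measurable borel"
  shows "(\<integral>\<^sup>+ x. g (map x) \<partial>lborel) = (\<integral>\<^sup>+ x. ennreal (inv_jac x) * g x \<partial>lborel)"
proof -
  have "(\<integral>\<^sup>+ x. g (map x) \<partial>lborel) = (\<integral>\<^sup>+ x. g x \<partial>distr lborel borel map)"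
    by (simp add: nn_integral_distr)
  then show ?thesis by (simp add: distr_map nn_integral_density)
qed

end

text \<open>
  If one of the integrals diverges, then so does the other, and both are \<open>0\<close> by convention: hence
  no integrability is assumed for the inequality.
\<close>

lemma integrable_mult_weight_iff:
    "integrable M (\<lambda>x. k x * g x) \<longleftrightarrow> integrable M g" (is ?A)
  and integral_mult_weight_le:
    "(LINT x|M. k x * g x) \<le> C * (LINT x|M. g x)" (is ?B)
  if [measurable]: "k \<in> borel_measurable M" "g \<in> borel_measurable M"
    and g: "\<And>x. 0 \<le> g x" and c: "0 < c" and k: "\<And>x. g x \<noteq> 0 \<Longrightarrow> c \<le> k x" "\<And>x. g x \<noteq> 0 \<Longrightarrow> k x \<le> C"
  for k g :: "'a \<Rightarrow> real"
proof -
  have lo: "c * g x \<le> k x * g x" and up: "k x * g x \<le> C * g x" for x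
    using k[of x] g[of x] by (cases "g x = 0"; simp add: mult_right_mono)+
  have nn: "0 \<le> k x * g x" for x
    using lo[of x] g[of x] c by (meson mult_nonneg_nonneg less_imp_le order_trans)
  show ?A
  proof
    assume "integrable M (\<lambda>x. k x * g x)"
    then have "integrable M (\<lambda>x. 1 / c * (k x * g x))" by simp
    then show "integrable M g"
    proof (rule Bochner_Integration.integrable_bound)
      show "AE x in M. norm (g x) \<le> norm (1 / c * (k x * g x))"
        using lo c g nn by (auto simp: field_simps abs_of_nonneg)
    qed measurable
  next
    assume "integrable M g"
    then have "integrable M (\<lambda>x. C * g x)" by simp
    then show "integrable M (\<lambda>x. k x * g x)"
    proof (rule Bochner_Integration.integrable_bound)
      show "AE x in M. norm (k x * g x) \<le> norm (C * g x)"
        using up nn by (intro AE_I2) (metis abs_ge_self abs_of_nonneg order_trans real_norm_def)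
    qed measurable
  qed
  then show ?B
  proof (cases "integrable M g")
    case True
    then have "(LINT x|M. k x * g x) \<le> (LINT x|M. C * g x)"
      using \<open>?A\<close> up by (intro integral_mono) auto
    then show ?thesis by simp
  next
    case False
    then show ?thesis using \<open>?A\<close> by (simp add: not_integrable_integral_eq)
  qed
qed

context warp
begin

lemma
  fixes v :: "'a \<Rightarrow> real"
  assumes [measurable]: "v \<in> borel_measurable borel" and s: "0 < s"
  shows integrable_energy_comp_self_iff:
      "integrable (lborel \<Otimes>\<^sub>M lborel) (energy_density s (\<lambda>x. v (map x)) (\<lambda>x. v (map x))) \<longleftrightarrow>
       integrable (lborel \<Otimes>\<^sub>M lborel) (energy_density s v v)" (is ?A)
    and integral_energy_comp_le:
      "(LINT z|(lborel \<Otimes>\<^sub>M lborel). energy_density s (\<lambda>x. v (map x)) (\<lambda>x. v (map x)) z) \<le>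
       2 ^ DIM('a) * 2 ^ DIM('a) * 2 powr (real DIM('a) + 2 * s) *
       (LINT z|(lborel \<Otimes>\<^sub>M lborel). energy_density s v v z)" (is ?B)
proof -
  let ?p = "real DIM('a) + 2 * s"
  \<comment> \<open>The lower bound for the weight fails on the diagonal, where the weight is 0, but
    the energy density vanishes there.\<close>
  have diag: "energy_density s v v z \<noteq> 0 \<Longrightarrow> fst z \<noteq> snd z" for z
    by (cases z) (auto simp: energy_density_def)
  have lo: "(1 / 2) ^ DIM('a) * (1 / 2) ^ DIM('a) * (1 / 2) powr ?p \<le> kernel_weight ?p z"
    if "energy_density s v v z \<noteq> 0" for z
    using kernel_weight_lower[of ?p "fst z" "snd z"] diag[OF that] s by simp
  have c: "0 < (1 / 2) ^ DIM('a) * (1 / 2) ^ DIM('a) * (1 / 2 :: real) powr ?p" by simp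
  have up: "kernel_weight ?p z \<le> 2 ^ DIM('a) * 2 ^ DIM('a) * 2 powr ?p" for z
    using kernel_weight_upper[of ?p z] s by simp
  note * = energy_density_nonneg c lo up
  show ?A
    unfolding integrable_energy_comp_iff[OF assms(1,1)]
    by (rule integrable_mult_weight_iff[OF _ _ *]) measurable
  show ?B
    unfolding integral_energy_comp[OF assms(1,1)]
    by (rule integral_mult_weight_le[OF _ _ *]) measurable
qed

lemma
  fixes v :: "'a \<Rightarrow> real"
  assumes [measurable]: "v \<in> borel_measurable borel"
  shows integrable_powr_comp_iff:
      "integrable lborel (\<lambda>x. \<bar>v (map x)\<bar> powr q) \<longleftrightarrow> integrable lborel (\<lambda>x. \<bar>v x\<bar> powr q)" (is ?A)
    and integral_powr_comp_le:
      "(LINT x|lborel. \<bar>v (map x)\<bar> powr q) \<le> 2 ^ DIM('a) * (LINT x|lborel. \<bar>v x\<bar> powr q)" (is ?B)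
proof -
  have m [measurable]: "(\<lambda>x. \<bar>v x\<bar> powr q) \<in> borel_measurable borel" by measurable
  note * = powr_ge_zero _ inv_jac_lower inv_jac_upper
  show ?A
    unfolding integrable_comp_map_iff[OF m]
    by (rule integrable_mult_weight_iff[OF _ _ *]) auto
  show ?B
    unfolding integral_comp_map[OF m]
    by (rule integral_mult_weight_le[OF _ _ *]) auto
qed

text \<open>This makes \<open>v \<circ> map\<close> admissible in the weak equation. Composition is
  bounded in the norm of the space and preserves test functions, so approximations of
  \<open>v\<close> become approximations of the composition.\<close>

lemma Hdot_comp_map:
  assumes s: "0 < s" "s < 1" "2 * s < real DIM('a)"
    and v: "v \<in> Hdot s" and [measurable]: "v \<in> borel_measurable borel"
  shows "(\<lambda>x. v (map x)) \<in> Hdot s"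
proof -
  let ?q = "crit_exp TYPE('a) s"
  let ?E = "2 ^ DIM('a) * 2 ^ DIM('a) * 2 powr (real DIM('a) + 2 * s) :: real"
  have q: "0 < ?q" using s by (simp add: crit_exp_def)
  obtain \<phi> where \<phi>: "\<And>k. test_function (\<phi> k)"
    and lim: "(\<lambda>k::nat. Hdot_norm s (\<lambda>x. v x - \<phi> k x)) \<longlonglongrightarrow> 0"
    using v by (auto simp: Hdot_def)
  have [measurable]: "\<phi> k \<in> borel_measurable borel" for k
    by (rule test_function_measurable[OF \<phi>])
  have fin: "(\<lambda>x. v (map x)) \<in> finite_Hdot_norm s"
    using v s unfolding Hdot_def finite_Hdot_norm_def
    by (simp add: integrable_lebesgue_pair_iff integrable_energy_comp_self_iff
        integrable_completion integrable_powr_comp_iff measurable_completion)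
  have c: "0 \<le> frac_const TYPE('a) s / 2"
    using frac_const_pos[of s, where 'a = 'a] s by simp
  have norm_nonneg: "0 \<le> Hdot_norm s d" for d :: "'a \<Rightarrow> real"
    using c by (auto simp: Hdot_norm_def Lp_norm_def energy_form_def energy_density_nonneg
      intro!: add_nonneg_nonneg mult_nonneg_nonneg)
  have bound: "Hdot_norm s (\<lambda>x. d (map x)) \<le> (sqrt ?E + (2 ^ DIM('a)) powr (1 / ?q)) * Hdot_norm s d"
    if [measurable]: "d \<in> borel_measurable borel" for d :: "'a \<Rightarrow> real"
  proof -
    have "energy_form s (\<lambda>x. d (map x)) (\<lambda>x. d (map x)) \<le> ?E * energy_form s d d"
      using mult_left_mono[OF integral_energy_comp_le[of d s] c] s
      by (simp add: energy_form_borel mult_ac)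
    then have 1: "sqrt (energy_form s (\<lambda>x. d (map x)) (\<lambda>x. d (map x))) \<le> sqrt ?E * sqrt (energy_form s d d)"
      by (simp flip: real_sqrt_mult)
    have "Lp_norm ?q (\<lambda>x. d (map x)) \<le> (2 ^ DIM('a) * (LINT x|lebesgue. \<bar>d x\<bar> powr ?q)) powr (1 / ?q)"
      unfolding Lp_norm_def using integral_powr_comp_le[of d ?q] q
      by (intro powr_mono2) (simp_all add: integral_completion)
    also have "\<dots> = (2 ^ DIM('a)) powr (1 / ?q) * Lp_norm ?q d"
      by (simp add: Lp_norm_def powr_mult)
    finally have 2: "Lp_norm ?q (\<lambda>x. d (map x)) \<le> (2 ^ DIM('a)) powr (1 / ?q) * Lp_norm ?q d" .
    have "0 \<le> sqrt (energy_form s d d)"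
      using c by (auto simp: energy_form_def energy_density_nonneg intro!: mult_nonneg_nonneg)
    moreover have "0 \<le> Lp_norm ?q d" by (simp add: Lp_norm_def)
    ultimately have "sqrt ?E * sqrt (energy_form s d d) + (2 ^ DIM('a)) powr (1 / ?q) * Lp_norm ?q d \<le>
      (sqrt ?E + (2 ^ DIM('a)) powr (1 / ?q)) * Hdot_norm s d"
      by (simp add: Hdot_norm_def algebra_simps)
    then show ?thesis using 1 2 unfolding Hdot_norm_def[of s "\<lambda>x. d (map x)"] by linarith
  qed
  have "(\<lambda>k. Hdot_norm s (\<lambda>x. v (map x) - \<phi> k (map x))) \<longlonglongrightarrow> 0"
  proof (rule tendsto_sandwich)
    show "\<forall>\<^sub>F k in sequentially. 0 \<le> Hdot_norm s (\<lambda>x. v (map x) - \<phi> k (map x))"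
      by (simp add: norm_nonneg)
    show "\<forall>\<^sub>F k in sequentially. Hdot_norm s (\<lambda>x. v (map x) - \<phi> k (map x)) \<le>
       (sqrt ?E + (2 ^ DIM('a)) powr (1 / ?q)) * Hdot_norm s (\<lambda>x. v x - \<phi> k x)"
      by (intro always_eventually allI bound) measurable
    show "(\<lambda>k. (sqrt ?E + (2 ^ DIM('a)) powr (1 / ?q)) * Hdot_norm s (\<lambda>x. v x - \<phi> k x)) \<longlonglongrightarrow> 0"
      using tendsto_mult_right_zero[OF lim] by simp
  qed simp
  moreover have "test_function (\<lambda>x. \<phi> k (map x))" for k
    by (rule test_function_comp_map[OF \<phi>])
  ultimately show ?thesis
    using fin unfolding Hdot_def by (auto intro!: exI[of _ "\<lambda>k x. \<phi> k (map x)"])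
qed

end

subsection \<open>Displacement estimates\<close>

text \<open>The energy of pairs at distance at most \<open>r\<close>, without the singular kernel.
  It is bounded by the full energy and by the supremum of \<open>shift_energy\<close>, up to powers
  of \<open>r\<close>, and it controls the displacement by a warp.\<close>

definition near_energy :: "real \<Rightarrow> ('a::euclidean_space \<Rightarrow> real) \<Rightarrow> ennreal" where
  "near_energy r v = (\<integral>\<^sup>+ x. \<integral>\<^sup>+ z. indicator (cball x r) z * ennreal ((v x - v z)\<^sup>2) \<partial>lborel \<partial>lborel)"

definition shift_energy :: "('a::euclidean_space \<Rightarrow> real) \<Rightarrow> 'a \<Rightarrow> ennreal" where
  "shift_energy v h = (\<integral>\<^sup>+ x. ennreal ((v (x + h) - v x)\<^sup>2) \<partial>lborel)"

text \<open>The factor 2 is from \<open>(a + b)\<^sup>2 \<le> 2 * a\<^sup>2 + 2 * b\<^sup>2\<close>,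
  the summands \<open>2 ^ DIM('a)\<close> and 1 are from the balls around \<open>map x\<close> and
  \<open>x\<close>, and the division is by the volume of the ball over which the average is
  taken.\<close>

definition avg_const :: "'a::euclidean_space itself \<Rightarrow> real" where
  "avg_const _ = 2 * (2 ^ DIM('a) + 1) / unit_ball_vol DIM('a)"

lemma ennreal_mult_assoc: "0 \<le> a \<Longrightarrow> ennreal a * (ennreal b * X) = ennreal (a * b) * X"
  by (simp add: ennreal_mult' mult.assoc)

lemma indicator_cball_measurable [measurable]:
  "(\<lambda>z. indicator (cball (fst z) r) (snd z) :: ennreal) \<in>
     borel_measurable (borel \<Otimes>\<^sub>M (borel :: 'a::euclidean_space measure))"
proof -
  have "(\<lambda>z::'a \<times> 'a. indicator (cball (fst z) r) (snd z) :: ennreal) =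
      (\<lambda>z. if norm (fst z - snd z) \<le> r then 1 else 0)"
    by (auto simp: indicator_def dist_norm)
  also have "\<dots> \<in> borel_measurable (borel \<Otimes>\<^sub>M borel)" by measurable
  finally show ?thesis .
qed

lemma indicator_cball_measurable' [measurable]:
  fixes a b :: "'b \<Rightarrow> 'a::euclidean_space"
  assumes [measurable]: "a \<in> borel_measurable M" "b \<in> borel_measurable M"
  shows "(\<lambda>x. indicator (cball (a x) r) (b x) :: ennreal) \<in> borel_measurable M"
  using measurable_compose[OF measurable_Pair[OF assms] indicator_cball_measurable[of r]] by simp

text \<open>For distances at most \<open>r\<close> the kernel is at least its value at distance
  \<open>r\<close>.\<close>

lemma near_energy_le_energy:
  fixes v :: "'a::euclidean_space \<Rightarrow> real"
  assumes [measurable]: "v \<in> borel_measurable borel" and s: "0 < s" and r: "0 < r"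
  shows "near_energy r v \<le> ennreal (r powr (real DIM('a) + 2 * s)) *
    (\<integral>\<^sup>+ z. ennreal (energy_density s v v z) \<partial>(lborel \<Otimes>\<^sub>M lborel))"
proof -
  let ?p = "real DIM('a) + 2 * s"
  have "near_energy r v \<le> (\<integral>\<^sup>+ x. \<integral>\<^sup>+ z. ennreal (r powr ?p) * ennreal (energy_density s v v (x, z)) \<partial>lborel \<partial>lborel)"
    unfolding near_energy_def
  proof (intro nn_integral_mono)
    fix x z :: 'a
    show "indicator (cball x r) z * ennreal ((v x - v z)\<^sup>2) \<le> ennreal (r powr ?p) * ennreal (energy_density s v v (x, z))"
    proof (cases "x = z \<or> z \<notin> cball x r")
      case False
      then have n: "0 < norm (x - z)" "norm (x - z) \<le> r" by (auto simp: dist_norm)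
      have "norm (x - z) powr ?p \<le> r powr ?p" using n s by (intro powr_mono2) auto
      then have "(v x - v z)\<^sup>2 \<le> r powr ?p * ((v x - v z)\<^sup>2 / norm (x - z) powr ?p)"
        using n by (simp add: field_simps mult_left_mono)
      then show ?thesis using False
        by (simp add: energy_density_def power2_eq_square flip: ennreal_mult')
    qed auto
  qed
  also have "\<dots> = ennreal (r powr ?p) * (\<integral>\<^sup>+ x. \<integral>\<^sup>+ z. ennreal (energy_density s v v (x, z)) \<partial>lborel \<partial>lborel)"
    by (simp add: nn_integral_cmult)
  also have "(\<integral>\<^sup>+ x. \<integral>\<^sup>+ z. ennreal (energy_density s v v (x, z)) \<partial>lborel \<partial>lborel) =
     (\<integral>\<^sup>+ z. ennreal (energy_density s v v z) \<partial>(lborel \<Otimes>\<^sub>M lborel))"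
    by (rule lborel.nn_integral_fst) simp
  finally show ?thesis .
qed

text \<open>Write \<open>z = x + h\<close> and interchange the integrals: each \<open>h\<close> in
  the ball contributes \<open>shift_energy v h\<close>.\<close>

lemma near_energy_le_shift:
  fixes v :: "'a::euclidean_space \<Rightarrow> real"
  assumes [measurable]: "v \<in> borel_measurable borel" and r: "0 \<le> r"
    and S: "\<And>h. norm h \<le> r \<Longrightarrow> shift_energy v h \<le> S"
  shows "near_energy r v \<le> ennreal (unit_ball_vol DIM('a) * r ^ DIM('a)) * S"
proof -
  have "near_energy r v = (\<integral>\<^sup>+ x. \<integral>\<^sup>+ h. indicator (cball 0 r) h * ennreal ((v (x + h) - v x)\<^sup>2) \<partial>lborel \<partial>lborel)"
    unfolding near_energy_def
  proof (rule nn_integral_cong)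
    fix x :: 'a
    have "(\<integral>\<^sup>+ z. indicator (cball x r) z * ennreal ((v x - v z)\<^sup>2) \<partial>lborel) =
       (\<integral>\<^sup>+ z. indicator (cball x r) z * ennreal ((v x - v z)\<^sup>2) \<partial>distr lborel borel ((+) x))"
      by (simp add: lborel_distr_plus)
    also have "\<dots> = (\<integral>\<^sup>+ h. indicator (cball x r) (x + h) * ennreal ((v x - v (x + h))\<^sup>2) \<partial>lborel)"
      by (rule nn_integral_distr) auto
    also have "\<dots> = (\<integral>\<^sup>+ h. indicator (cball 0 r) h * ennreal ((v (x + h) - v x)\<^sup>2) \<partial>lborel)"
      by (rule nn_integral_cong) (auto simp: indicator_def dist_norm power2_commute)
    finally show "(\<integral>\<^sup>+ z. indicator (cball x r) z * ennreal ((v x - v z)\<^sup>2) \<partial>lborel) =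
      (\<integral>\<^sup>+ h. indicator (cball 0 r) h * ennreal ((v (x + h) - v x)\<^sup>2) \<partial>lborel)" .
  qed
  also have "\<dots> = (\<integral>\<^sup>+ h. \<integral>\<^sup>+ x. indicator (cball 0 r) h * ennreal ((v (x + h) - v x)\<^sup>2) \<partial>lborel \<partial>lborel)"
    by (rule lborel_pair.Fubini'[symmetric]) measurable
  also have "\<dots> = (\<integral>\<^sup>+ h. indicator (cball 0 r) h * shift_energy v h \<partial>lborel)"
    by (simp add: shift_energy_def nn_integral_cmult)
  also have "\<dots> \<le> (\<integral>\<^sup>+ h. S * indicator (cball 0 r) (h::'a) \<partial>lborel)"
    by (rule nn_integral_mono) (auto simp: indicator_def S)
  also have "\<dots> = ennreal (unit_ball_vol DIM('a) * r ^ DIM('a)) * S"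
    using r by (subst nn_integral_cmult_indicator) (auto simp: emeasure_cball mult.commute)
  finally show ?thesis .
qed

context warp
begin

text \<open>
  Both \<open>x\<close> and \<open>map x\<close> are close to every point of a ball around \<open>x\<close>; average over that ball.
\<close>

lemma displacement_le_near_energy:
  fixes v :: "'a \<Rightarrow> real"
  assumes [measurable]: "v \<in> borel_measurable borel"
    and d: "0 < d" "\<And>x. norm (map x - x) \<le> d"
  shows "(\<integral>\<^sup>+ x. ennreal ((v (map x) - v x)\<^sup>2) \<partial>lborel) \<le>
    ennreal (avg_const TYPE('a) / d ^ DIM('a)) * near_energy (2 * d) v"
proof -
  define V where "V = unit_ball_vol DIM('a) * d ^ DIM('a)"
  define g where "g y = (\<integral>\<^sup>+ z. indicator (cball y (2 * d)) z * ennreal ((v y - v z)\<^sup>2) \<partial>lborel)" for y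
  have V: "0 < V" using d by (simp add: V_def)
  have [measurable]: "g \<in> borel_measurable borel" unfolding g_def by measurable
  have pt: "ennreal V * ennreal ((v (map x) - v x)\<^sup>2) \<le> 2 * g (map x) + 2 * g x" for x
  proof -
    have "ennreal V * ennreal ((v (map x) - v x)\<^sup>2) =
        (\<integral>\<^sup>+ z. ennreal ((v (map x) - v x)\<^sup>2) * indicator (cball x d) z \<partial>lborel)"
      using d by (subst nn_integral_cmult_indicator) (auto simp: emeasure_cball V_def mult.commute)
    also have "\<dots> \<le> (\<integral>\<^sup>+ z. 2 * (indicator (cball (map x) (2 * d)) z * ennreal ((v (map x) - v z)\<^sup>2)) +
        2 * (indicator (cball x (2 * d)) z * ennreal ((v x - v z)\<^sup>2)) \<partial>lborel)"
    proof (rule nn_integral_mono)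
      fix z :: 'a
      show "ennreal ((v (map x) - v x)\<^sup>2) * indicator (cball x d) z \<le>
        2 * (indicator (cball (map x) (2 * d)) z * ennreal ((v (map x) - v z)\<^sup>2)) +
        2 * (indicator (cball x (2 * d)) z * ennreal ((v x - v z)\<^sup>2))"
      proof (cases "z \<in> cball x d")
        case True
        have "dist (map x) z \<le> dist (map x) x + dist x z" by (rule dist_triangle)
        also have "\<dots> \<le> 2 * d" using True d(2)[of x] by (simp add: dist_norm)
        finally have 1: "z \<in> cball (map x) (2 * d)" "z \<in> cball x (2 * d)" using True d(1) by auto
        have "(v (map x) - v x)\<^sup>2 \<le> 2 * (v (map x) - v z)\<^sup>2 + 2 * (v x - v z)\<^sup>2"
          using sum_squares_bound[of "v (map x) - v z" "- (v x - v z)"]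
          by (simp add: power2_eq_square algebra_simps)
        then have "ennreal ((v (map x) - v x)\<^sup>2) \<le> ennreal (2 * (v (map x) - v z)\<^sup>2 + 2 * (v x - v z)\<^sup>2)"
          by (rule ennreal_leI)
        also have "\<dots> = 2 * ennreal ((v (map x) - v z)\<^sup>2) + 2 * ennreal ((v x - v z)\<^sup>2)"
          by (simp add: ennreal_plus ennreal_mult')
        finally show ?thesis using True 1 by simp
      qed simp
    qed
    also have "\<dots> = 2 * g (map x) + 2 * g x"
      unfolding g_def by (subst nn_integral_add; simp add: nn_integral_cmult)
    finally show ?thesis .
  qed
  have G: "(\<integral>\<^sup>+ x. g x \<partial>lborel) = near_energy (2 * d) v"
    by (simp add: near_energy_def g_def)
  have "(\<integral>\<^sup>+ x. g (map x) \<partial>lborel) = (\<integral>\<^sup>+ x. ennreal (inv_jac x) * g x \<partial>lborel)"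
    by (rule nn_integral_comp_map) simp
  also have "\<dots> \<le> (\<integral>\<^sup>+ x. ennreal (2 ^ DIM('a)) * g x \<partial>lborel)"
    by (intro nn_integral_mono mult_right_mono ennreal_leI inv_jac_upper) auto
  also have "\<dots> = ennreal (2 ^ DIM('a)) * near_energy (2 * d) v"
    by (simp add: nn_integral_cmult G)
  finally have Gmap: "(\<integral>\<^sup>+ x. g (map x) \<partial>lborel) \<le> ennreal (2 ^ DIM('a)) * near_energy (2 * d) v" .
  have "ennreal V * (\<integral>\<^sup>+ x. ennreal ((v (map x) - v x)\<^sup>2) \<partial>lborel) =
      (\<integral>\<^sup>+ x. ennreal V * ennreal ((v (map x) - v x)\<^sup>2) \<partial>lborel)"
    by (simp add: nn_integral_cmult)
  also have "\<dots> \<le> (\<integral>\<^sup>+ x. 2 * g (map x) + 2 * g x \<partial>lborel)"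
    by (intro nn_integral_mono pt)
  also have "\<dots> = 2 * (\<integral>\<^sup>+ x. g (map x) \<partial>lborel) + 2 * near_energy (2 * d) v"
    by (subst nn_integral_add; simp add: nn_integral_cmult G)
  also have "\<dots> \<le> 2 * (ennreal (2 ^ DIM('a)) * near_energy (2 * d) v) + 2 * near_energy (2 * d) v"
    by (rule add_right_mono[OF mult_left_mono[OF Gmap]]) simp
  finally have le: "ennreal V * (\<integral>\<^sup>+ x. ennreal ((v (map x) - v x)\<^sup>2) \<partial>lborel) \<le>
     2 * (ennreal (2 ^ DIM('a)) * near_energy (2 * d) v) + 2 * near_energy (2 * d) v" .
  have "2 * (ennreal (2 ^ DIM('a)) * near_energy (2 * d) v) + 2 * near_energy (2 * d) v =
     ennreal (2 * (2 ^ DIM('a) + 1)) * near_energy (2 * d) v"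
  proof -
    have "ennreal (2 * (2 ^ DIM('a) + 1)) = 2 * (ennreal (2 ^ DIM('a)) + 1)"
      by (simp add: ennreal_mult' ennreal_plus)
    then show ?thesis by (simp add: distrib_left distrib_right mult.assoc)
  qed
  with le have "ennreal (1 / V) * (ennreal V * (\<integral>\<^sup>+ x. ennreal ((v (map x) - v x)\<^sup>2) \<partial>lborel)) \<le>
     ennreal (1 / V) * (ennreal (2 * (2 ^ DIM('a) + 1)) * near_energy (2 * d) v)"
    by (intro mult_left_mono) auto
  also have "ennreal (1 / V) * (ennreal V * (\<integral>\<^sup>+ x. ennreal ((v (map x) - v x)\<^sup>2) \<partial>lborel)) =
      (\<integral>\<^sup>+ x. ennreal ((v (map x) - v x)\<^sup>2) \<partial>lborel)"
    using V by (simp add: ennreal_mult_assoc)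
  also have "ennreal (1 / V) * (ennreal (2 * (2 ^ DIM('a) + 1)) * near_energy (2 * d) v) =
     ennreal (avg_const TYPE('a) / d ^ DIM('a)) * near_energy (2 * d) v"
  proof -
    have "1 / V * (2 * (2 ^ DIM('a) + 1)) = avg_const TYPE('a) / d ^ DIM('a)"
      by (simp add: avg_const_def V_def)
    then show ?thesis using V by (subst ennreal_mult_assoc) auto
  qed
  finally show ?thesis .
qed

end

lemma avg_const_nonneg: "0 \<le> avg_const TYPE('a::euclidean_space)"
  by (simp add: avg_const_def)

text \<open>Dividing by the volume of the ball leaves only the power \<open>d powr (2 * s)\<close>.
  This is the estimate of differences by the energy, for displacements that may vary with the
  point.\<close>

lemma (in warp) displacement_le_energy:
  fixes v :: "'a \<Rightarrow> real"
  assumes v [measurable]: "v \<in> borel_measurable borel" and s: "0 < s"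
    and d: "0 < d" "\<And>x. norm (map x - x) \<le> d"
  shows "(\<integral>\<^sup>+ x. ennreal ((v (map x) - v x)\<^sup>2) \<partial>lborel) \<le>
    ennreal (avg_const TYPE('a) * 2 powr (real DIM('a) + 2 * s) * d powr (2 * s)) *
    (\<integral>\<^sup>+ z. ennreal (energy_density s v v z) \<partial>(lborel \<Otimes>\<^sub>M lborel))"
proof -
  have "(\<integral>\<^sup>+ x. ennreal ((v (map x) - v x)\<^sup>2) \<partial>lborel) \<le>
    ennreal (avg_const TYPE('a) / d ^ DIM('a)) * (ennreal ((2 * d) powr (real DIM('a) + 2 * s)) *
    (\<integral>\<^sup>+ z. ennreal (energy_density s v v z) \<partial>(lborel \<Otimes>\<^sub>M lborel)))"
    using displacement_le_near_energy[OF v d] near_energy_le_energy[OF v s, of "2 * d"] d(1)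
    by (meson mult_left_mono order_trans zero_le mult_pos_pos zero_less_numeral)
  also have "avg_const TYPE('a) / d ^ DIM('a) * (2 * d) powr (real DIM('a) + 2 * s) =
      avg_const TYPE('a) * 2 powr (real DIM('a) + 2 * s) * d powr (2 * s)"
    using d(1) by (simp add: powr_mult powr_add powr_realpow)
  then have "ennreal (avg_const TYPE('a) / d ^ DIM('a)) * (ennreal ((2 * d) powr (real DIM('a) + 2 * s)) *
    (\<integral>\<^sup>+ z. ennreal (energy_density s v v z) \<partial>(lborel \<Otimes>\<^sub>M lborel))) =
    ennreal (avg_const TYPE('a) * 2 powr (real DIM('a) + 2 * s) * d powr (2 * s)) *
    (\<integral>\<^sup>+ z. ennreal (energy_density s v v z) \<partial>(lborel \<Otimes>\<^sub>M lborel))"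
    using d(1) avg_const_nonneg[where 'a = 'a] by (simp add: ennreal_mult_assoc)
  finally show ?thesis .
qed

text \<open>A displacement that depends on the point is controlled by the rigid translations of
  length at most \<open>2 * d\<close>; the powers of \<open>d\<close> from the average and from the
  ball cancel.\<close>

lemma (in warp) displacement_le_shift:
  fixes v :: "'a \<Rightarrow> real"
  assumes v [measurable]: "v \<in> borel_measurable borel"
    and d: "0 < d" "\<And>x. norm (map x - x) \<le> d"
    and S: "\<And>h. norm h \<le> 2 * d \<Longrightarrow> shift_energy v h \<le> S"
  shows "(\<integral>\<^sup>+ x. ennreal ((v (map x) - v x)\<^sup>2) \<partial>lborel) \<le>
    ennreal (avg_const TYPE('a) * unit_ball_vol DIM('a) * 2 ^ DIM('a)) * S"
proof -
  have "(\<integral>\<^sup>+ x. ennreal ((v (map x) - v x)\<^sup>2) \<partial>lborel) \<le>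
    ennreal (avg_const TYPE('a) / d ^ DIM('a)) *
      (ennreal (unit_ball_vol DIM('a) * (2 * d) ^ DIM('a)) * S)"
    using displacement_le_near_energy[OF v d] near_energy_le_shift[OF v _ S] d(1)
    by (meson mult_left_mono order_trans zero_le mult_nonneg_nonneg less_imp_le zero_le_numeral)
  also have "avg_const TYPE('a) / d ^ DIM('a) * (unit_ball_vol DIM('a) * (2 * d) ^ DIM('a)) =
      avg_const TYPE('a) * unit_ball_vol DIM('a) * 2 ^ DIM('a)"
    using d(1) by (simp add: power_mult_distrib)
  then have "ennreal (avg_const TYPE('a) / d ^ DIM('a)) *
      (ennreal (unit_ball_vol DIM('a) * (2 * d) ^ DIM('a)) * S) =
    ennreal (avg_const TYPE('a) * unit_ball_vol DIM('a) * 2 ^ DIM('a)) * S"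
    using d(1) avg_const_nonneg[where 'a = 'a] by (simp add: ennreal_mult_assoc mult.assoc)
  finally show ?thesis .
qed

subsection \<open>The deformation inequality\<close>

lemma
  fixes g :: "'b \<Rightarrow> real"
  assumes "g \<in> borel_measurable M" "\<And>x. 0 \<le> g x" "0 \<le> c"
    and le: "(\<integral>\<^sup>+ x. ennreal (g x) \<partial>M) \<le> ennreal c"
  shows integrable_of_nn_integral_le: "integrable M g"
    and integral_le_of_nn_integral_le: "(LINT x|M. g x) \<le> c"
proof -
  show "integrable M g"
    using assms by (intro integrableI_nonneg) (auto intro: le_less_trans)
  then show "(LINT x|M. g x) \<le> c"
    using assms by (simp add: nn_integral_eq_integral)
qed

section \<open>Translations as warps\<close>

lemma warp_translation: "warp 0 1"
  by unfold_locales auto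

lemma map_translation: "warp.map h 0 1 x = x + h"
proof -
  interpret warp h 0 1 by (rule warp_translation)
  show ?thesis by (rule euclidean_eqI) (simp add: coord_def inner_add_left)
qed

lemma inv_jac_translation: "warp.inv_jac h 0 1 x = 1"
proof -
  interpret warp h 0 1 by (rule warp_translation)
  show ?thesis by (simp add: inv_jac_def jac_def)
qed

lemma kernel_weight_translation: "x \<noteq> y \<Longrightarrow> warp.kernel_weight h 0 1 p (x, y) = 1"
proof -
  assume xy: "x \<noteq> y"
  interpret warp h 0 1 by (rule warp_translation)
  have "inv_map x = x - h" for x
    using inv_map_map[of "x - h"] by (simp add: map_translation)
  then show ?thesis using xy by (simp add: kernel_weight_def inv_jac_translation)
qed

text \<open>A translation is a warp whose displacement has length \<open>norm h\<close> everywhere;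
  \<open>h \<noteq> 0\<close> makes this an admissible positive bound.\<close>

lemma
  fixes v :: "'a::euclidean_space \<Rightarrow> real"
  assumes v [measurable]: "v \<in> borel_measurable borel" and s: "0 < s" and h: "h \<noteq> 0"
    and int: "integrable (lborel \<Otimes>\<^sub>M lborel) (energy_density s v v)"
  shows integrable_shift: "integrable lborel (\<lambda>x. (v (x + h) - v x)\<^sup>2)"
    and integral_shift_le: "(LINT x|lborel. (v (x + h) - v x)\<^sup>2) \<le>
      avg_const TYPE('a) * 2 powr (real DIM('a) + 2 * s) * norm h powr (2 * s) *
      (LINT z|(lborel \<Otimes>\<^sub>M lborel). energy_density s v v z)"
proof -
  interpret warp h 0 1 by (rule warp_translation)
  let ?A = "avg_const TYPE('a) * 2 powr (real DIM('a) + 2 * s) * norm h powr (2 * s)"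
  have nn: "(\<integral>\<^sup>+ z. ennreal (energy_density s v v z) \<partial>(lborel \<Otimes>\<^sub>M lborel)) =
      ennreal (LINT z|(lborel \<Otimes>\<^sub>M lborel). energy_density s v v z)"
    by (rule nn_integral_eq_integral[OF int]) (simp add: energy_density_nonneg)
  have A: "0 \<le> ?A" by (simp add: avg_const_nonneg)
  have le: "(\<integral>\<^sup>+ x. ennreal ((v (x + h) - v x)\<^sup>2) \<partial>lborel) \<le>
      ennreal (?A * (LINT z|(lborel \<Otimes>\<^sub>M lborel). energy_density s v v z))"
    using displacement_le_energy[OF v s, of "norm h"] h A
    by (simp add: map_translation nn ennreal_mult')
  have nonneg: "0 \<le> ?A * (LINT z|(lborel \<Otimes>\<^sub>M lborel). energy_density s v v z)"
    using A by (intro mult_nonneg_nonneg[OF A] integral_nonneg) (auto simp: energy_density_nonneg)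
  show "integrable lborel (\<lambda>x. (v (x + h) - v x)\<^sup>2)"
    by (rule integrable_of_nn_integral_le[OF _ _ nonneg le]) auto
  show "(LINT x|lborel. (v (x + h) - v x)\<^sup>2) \<le>
      ?A * (LINT z|(lborel \<Otimes>\<^sub>M lborel). energy_density s v v z)"
    by (rule integral_le_of_nn_integral_le[OF _ _ nonneg le]) auto
qed

text \<open>What the argument uses of the solution: a Borel function with values in
  \<open>[0, C]\<close> everywhere, Taylor's inequality for \<open>F\<close> on that interval, and
  the weak equation tested with \<open>u \<circ> map\<close>. The number \<open>c\<close> stands for
  half of the constant of the fractional Laplacian.\<close>

locale bounded_solution =
  fixes s :: real and f F :: "real \<Rightarrow> real" and u :: "'a::euclidean_space \<Rightarrow> real" and C L c :: real
  assumes s: "0 < s" "s < 1" "2 * s < real DIM('a)"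
    and u_measurable [measurable]: "u \<in> borel_measurable borel"
    and u_range: "u x \<in> {0..C}"
    and c_pos: "0 < c"
    and L_nonneg: "0 \<le> L"
    and taylor: "a \<in> {0..C} \<Longrightarrow> b \<in> {0..C} \<Longrightarrow> F b - F a - L * (b - a)\<^sup>2 \<le> f a * (b - a)"
    and integrable_F: "integrable lborel (\<lambda>x. F (u x))"
    and integrable_energy: "integrable (lborel \<Otimes>\<^sub>M lborel) (energy_density s u u)"
    and integrable_weak: "warp t R \<Longrightarrow> integrable lborel (\<lambda>x. f (u x) * u (warp.map h t R x))"
    and weak: "warp t R \<Longrightarrow>
      c *
        (LINT z|(lborel \<Otimes>\<^sub>M lborel). energy_density s u (\<lambda>x. u (warp.map h t R x)) z) =
      (LINT x|lborel. f (u x) * u (warp.map h t R x))"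
begin

lemma weak_self:
  "integrable lborel (\<lambda>x. f (u x) * u x)"
  "c * (LINT z|(lborel \<Otimes>\<^sub>M lborel). energy_density s u u z) = (LINT x|lborel. f (u x) * u x)"
  \<comment> \<open>The translation by 0 gives \<open>u\<close> itself as a test function.\<close>
  using integrable_weak[OF warp_translation, of 0] weak[OF warp_translation, of 0]
  by (simp_all add: map_translation)

text \<open>Expand the quadratic form at \<open>v - u\<close>, where \<open>v\<close> is
  \<open>u \<circ> map\<close>. The weak equation replaces the mixed term and the energy of
  \<open>u\<close> by integrals of \<open>f (u x)\<close>, and Taylor's inequality compares these
  with \<open>F\<close>.\<close>

lemma
  fixes h :: 'a
  assumes W: "warp t R"
    and sq: "integrable lborel (\<lambda>x. (u (warp.map h t R x) - u x)\<^sup>2)"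
  shows integrable_energy_deformation:
      "integrable (lborel \<Otimes>\<^sub>M lborel)
        (energy_density s (\<lambda>x. u (warp.map h t R x) - u x) (\<lambda>x. u (warp.map h t R x) - u x))"
    and energy_deformation_le:
      "c * (LINT z|(lborel \<Otimes>\<^sub>M lborel).
          energy_density s (\<lambda>x. u (warp.map h t R x) - u x) (\<lambda>x. u (warp.map h t R x) - u x) z) \<le>
        c * (LINT z|(lborel \<Otimes>\<^sub>M lborel). (warp.kernel_weight h t R (real DIM('a) + 2 * s) z - 1) * energy_density s u u z)
        - 2 * (LINT x|lborel. (warp.inv_jac h t R x - 1) * F (u x))
        + 2 * L * (LINT x|lborel. (u (warp.map h t R x) - u x)\<^sup>2)"
proof -
  interpret warp h t R by fact
  let ?p = "real DIM('a) + 2 * s"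
  let ?L = "lborel \<Otimes>\<^sub>M lborel :: ('a \<times> 'a) measure"
  let ?v = "\<lambda>x. u (map x)" and ?w = "\<lambda>x. u (map x) - u x"
  have v_int: "integrable ?L (energy_density s ?v ?v)"
    using integrable_energy_comp_self_iff[of u s] s integrable_energy by simp
  have cross_int: "integrable ?L (energy_density s u ?v)"
  proof (rule Bochner_Integration.integrable_bound)
    show "integrable ?L (\<lambda>z. energy_density s u u z + energy_density s ?v ?v z)"
      using integrable_energy v_int by simp
    have ab: "\<bar>a * b\<bar> \<le> a * a + b * b" for a b :: real
    proof -
      have "2 * (\<bar>a\<bar> * \<bar>b\<bar>) \<le> a * a + b * b"
        using sum_squares_bound[of "\<bar>a\<bar>" "\<bar>b\<bar>"] by (simp add: power2_eq_square)
      moreover have "0 \<le> \<bar>a\<bar> * \<bar>b\<bar>" by simp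
      ultimately show ?thesis unfolding abs_mult by linarith
    qed
    have "\<bar>energy_density s u ?v z\<bar> \<le> energy_density s u u z + energy_density s ?v ?v z" for z
      using divide_right_mono[OF ab[of "u (fst z) - u (snd z)" "?v (fst z) - ?v (snd z)"],
          of "norm (fst z - snd z) powr ?p"]
      by (simp add: energy_density_def split_beta' add_divide_distrib abs_divide)
    then show "AE z in ?L. norm (energy_density s u ?v z) \<le>
        norm (energy_density s u u z + energy_density s ?v ?v z)"
      by (intro AE_I2) (metis abs_ge_self order_trans real_norm_def)
  qed measurable
  have split: "energy_density s ?w ?w z =
      energy_density s ?v ?v z + energy_density s u u z - 2 * energy_density s u ?v z" for z
  proof -
    obtain x y where z: "z = (x, y)" by force
    have "(?w x - ?w y) * (?w x - ?w y) = (?v x - ?v y) * (?v x - ?v y) + (u x - u y) * (u x - u y)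
        - 2 * ((u x - u y) * (?v x - ?v y))"
      by (simp add: algebra_simps)
    then show ?thesis
      by (simp add: z energy_density_def add_divide_distrib diff_divide_distrib)
  qed
  show "integrable ?L (energy_density s ?w ?w)"
    unfolding split[abs_def] using v_int integrable_energy cross_int by simp
  have weight_int: "integrable ?L (\<lambda>z. kernel_weight ?p z * energy_density s u u z)"
    using v_int by (simp add: integrable_energy_comp_iff)
  have "c * (LINT z|?L. energy_density s ?w ?w z) =
      c * (LINT z|?L. energy_density s ?v ?v z) + c * (LINT z|?L. energy_density s u u z)
      - 2 * (LINT x|lborel. f (u x) * ?v x)"
    unfolding split using v_int integrable_energy cross_int weak[OF W, of h]
    by (simp add: algebra_simps)
  also have "(LINT z|?L. energy_density s ?v ?v z) = (LINT z|?L. kernel_weight ?p z * energy_density s u u z)"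
    by (rule integral_energy_comp) simp_all
  also have "c * (LINT z|?L. kernel_weight ?p z * energy_density s u u z) =
      c * (LINT z|?L. (kernel_weight ?p z - 1) * energy_density s u u z) +
      c * (LINT z|?L. energy_density s u u z)"
    using weight_int integrable_energy by (simp add: algebra_simps)
  also have "c * (LINT z|?L. energy_density s u u z) = (LINT x|lborel. f (u x) * u x)"
    by (rule weak_self)
  \<comment> \<open>The energy of \<open>u\<close> occurs twice, once by itself and once split off
    from the weighted integral; together with the mixed term this makes \<open>- 2\<close> times the
    integral against \<open>v - u\<close>.\<close>
  finally have 1: "c * (LINT z|?L. energy_density s ?w ?w z) =
      c * (LINT z|?L. (kernel_weight ?p z - 1) * energy_density s u u z)
      - 2 * (LINT x|lborel. f (u x) * ?w x)"
    using integrable_weak[OF W, of h] weak_self(1) by (simp add: algebra_simps)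
  have F_meas [measurable]: "(\<lambda>x. F (u x)) \<in> borel_measurable borel"
    using borel_measurable_integrable[OF integrable_F] by simp
  have FJ_int: "integrable lborel (\<lambda>x. inv_jac x * F (u x))"
  proof (rule Bochner_Integration.integrable_bound)
    show "integrable lborel (\<lambda>x. 2 ^ DIM('a) * F (u x))" using integrable_F by simp
    show "AE x in lborel. norm (inv_jac x * F (u x)) \<le> norm (2 ^ DIM('a) * F (u x))"
      using inv_jac_upper inv_jac_pos
      by (intro AE_I2) (simp add: abs_mult mult_right_mono less_imp_le)
  qed measurable
  then have Fv_int: "integrable lborel (\<lambda>x. F (?v x))"
    using integrable_comp_map_iff[OF F_meas] by simp
  \<comment> \<open>The inequality \<open>taylor\<close> is integrated at \<open>a = u x\<close> and
    \<open>b = u (map x)\<close>; a change of variables moves the deformation in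
    \<open>F (u (map x))\<close> into \<open>inv_jac\<close>.\<close>
  have "(LINT x|lborel. (inv_jac x - 1) * F (u x)) - L * (LINT x|lborel. (?w x)\<^sup>2) =
      (LINT x|lborel. F (?v x) - F (u x) - L * (?w x)\<^sup>2)"
    using FJ_int Fv_int integrable_F sq integral_comp_map[OF F_meas]
    by (simp add: left_diff_distrib)
  also have "\<dots> \<le> (LINT x|lborel. f (u x) * ?w x)"
  proof (rule integral_mono)
    show "integrable lborel (\<lambda>x. F (?v x) - F (u x) - L * (?w x)\<^sup>2)"
      using Fv_int integrable_F sq by simp
    show "integrable lborel (\<lambda>x. f (u x) * ?w x)"
      using integrable_weak[OF W, of h] weak_self(1) by (simp add: right_diff_distrib)
    show "F (?v x) - F (u x) - L * (?w x)\<^sup>2 \<le> f (u x) * ?w x" for x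
      by (rule taylor) (rule u_range)+
  qed
  finally show "c * (LINT z|?L. energy_density s ?w ?w z) \<le>
      c * (LINT z|?L. (kernel_weight ?p z - 1) * energy_density s u u z)
        - 2 * (LINT x|lborel. (inv_jac x - 1) * F (u x)) + 2 * L * (LINT x|lborel. (?w x)\<^sup>2)"
    using 1 by linarith
qed

end

subsection \<open>Regularity in the sense of translations\<close>

context bounded_solution
begin

text \<open>For a translation the Jacobian is 1, and so is the weight off the diagonal. Of the
  deformation inequality only the Taylor remainder is left.\<close>

lemma
  assumes h: "h \<noteq> 0"
  shows integrable_energy_shift:
      "integrable (lborel \<Otimes>\<^sub>M lborel) (energy_density s (\<lambda>x. u (x + h) - u x) (\<lambda>x. u (x + h) - u x))"
    and energy_shift_le:
      "c * (LINT z|(lborel \<Otimes>\<^sub>M lborel). energy_density s (\<lambda>x. u (x + h) - u x) (\<lambda>x. u (x + h) - u x) z) \<le>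
       2 * L * (LINT x|lborel. (u (x + h) - u x)\<^sup>2)"
proof -
  note sq = integrable_shift[OF u_measurable s(1) h integrable_energy]
  have weight: "(warp.kernel_weight h 0 1 (real DIM('a) + 2 * s) z - 1) * energy_density s u u z = 0" for z
    by (cases z; cases "fst z = snd z") (auto simp: kernel_weight_translation energy_density_def)
  show "integrable (lborel \<Otimes>\<^sub>M lborel) (energy_density s (\<lambda>x. u (x + h) - u x) (\<lambda>x. u (x + h) - u x))"
    using integrable_energy_deformation[OF warp_translation, of h] sq by (simp add: map_translation)
  show "c * (LINT z|(lborel \<Otimes>\<^sub>M lborel). energy_density s (\<lambda>x. u (x + h) - u x) (\<lambda>x. u (x + h) - u x) z) \<le>
       2 * L * (LINT x|lborel. (u (x + h) - u x)\<^sup>2)"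
    using energy_deformation_le[OF warp_translation, of h] sq
    by (simp add: map_translation inv_jac_translation weight)
qed

text \<open>Let \<open>w\<close> be the first difference. The difference of \<open>w\<close> is
  bounded through the energy of \<open>w\<close>, and this energy again by the square integral of
  \<open>w\<close>. Thus the square integral of the second difference is smaller than that of the
  first by a factor of order \<open>norm h powr (2 * s)\<close>.\<close>

lemma second_difference_le:
  assumes h: "h \<noteq> 0"
  shows "4 * (LINT x|lborel. (u (x + h) - u x)\<^sup>2) \<le>
    5 / 4 * (LINT x|lborel. (u (x + 2 *\<^sub>R h) - u x)\<^sup>2) +
    5 * (avg_const TYPE('a) * 2 powr (real DIM('a) + 2 * s) * norm h powr (2 * s) * (2 * L / c)) *
      (LINT x|lborel. (u (x + h) - u x)\<^sup>2)"
proof -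
  let ?w = "\<lambda>x. u (x + h) - u x"
  let ?A = "avg_const TYPE('a) * 2 powr (real DIM('a) + 2 * s) * norm h powr (2 * s)"
  have w [measurable]: "?w \<in> borel_measurable borel" by measurable
  note sq = integrable_shift[OF u_measurable s(1) h integrable_energy]
  have sq2: "integrable lborel (\<lambda>x. (u (x + 2 *\<^sub>R h) - u x)\<^sup>2)"
    by (rule integrable_shift[OF u_measurable s(1) _ integrable_energy]) (use h in simp)
  note sqw = integrable_shift[OF w s(1) h integrable_energy_shift[OF h]]
  have "(LINT x|lborel. (?w (x + h) - ?w x)\<^sup>2) \<le>
      ?A * (LINT z|(lborel \<Otimes>\<^sub>M lborel). energy_density s ?w ?w z)"
    by (rule integral_shift_le[OF w s(1) h integrable_energy_shift[OF h]])
  also have "\<dots> \<le> ?A * (2 * L / c * (LINT x|lborel. (?w x)\<^sup>2))"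
    using energy_shift_le[OF h] c_pos avg_const_nonneg[where 'a = 'a]
    by (intro mult_left_mono) (auto simp: field_simps)
  finally have A: "(LINT x|lborel. (?w (x + h) - ?w x)\<^sup>2) \<le> ?A * (2 * L / c) * (LINT x|lborel. (?w x)\<^sup>2)"
    by (simp add: mult.assoc)
  have "4 * (LINT x|lborel. (?w x)\<^sup>2) \<le>
      (LINT x|lborel. 5 / 4 * (u (x + 2 *\<^sub>R h) - u x)\<^sup>2 + 5 * (?w (x + h) - ?w x)\<^sup>2)"
    unfolding integral_mult_right_zero[symmetric]
  proof (rule integral_mono)
    fix x
    have eq: "(?w (x + h) - ?w x) = (u (x + 2 *\<^sub>R h) - u x) - 2 * ?w x"
      by (simp add: scaleR_2 add.assoc)
    \<comment> \<open>This is \<open>(p + q)\<^sup>2 \<le> (1 + \<epsilon>) * p\<^sup>2 + (1 + 1 /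
      \<epsilon>) * q\<^sup>2\<close> with \<open>\<epsilon> = 1 / 4\<close>, for
      \<open>2 * k = a - (a - 2 * k)\<close>. A coefficient of \<open>a\<^sup>2\<close> well below 2
      is what lets the decay exponent exceed 1.\<close>
    have "4 * k\<^sup>2 \<le> 5 / 4 * a\<^sup>2 + 5 * (a - 2 * k)\<^sup>2" for a k :: real
    proof -
      have "5 / 4 * a\<^sup>2 + 5 * (a - 2 * k)\<^sup>2 - 4 * k\<^sup>2 = (5 / 2 * a - 4 * k)\<^sup>2"
        by (simp add: power2_eq_square algebra_simps)
      then show ?thesis using zero_le_power2[of "5 / 2 * a - 4 * k"] by linarith
    qed
    then show "4 * (?w x)\<^sup>2 \<le> 5 / 4 * (u (x + 2 *\<^sub>R h) - u x)\<^sup>2 + 5 * (?w (x + h) - ?w x)\<^sup>2"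
      unfolding eq .
  qed (use sq sq2 sqw in simp_all)
  also have "\<dots> = 5 / 4 * (LINT x|lborel. (u (x + 2 *\<^sub>R h) - u x)\<^sup>2) +
      5 * (LINT x|lborel. (?w (x + h) - ?w x)\<^sup>2)"
    using sq2 sqw by simp
  finally show ?thesis using A by linarith
qed

text \<open>
  The exponent only has to exceed 1. It comes from \<open>5/14 \<le> 2 powr (-5/4)\<close>: for small \<open>h\<close> the
  preceding lemma gives the contraction \<open>g h \<le> 5/14 * g (2h)\<close>, which is iterated.
\<close>

lemma shift_decay:
  obtains M r where "0 \<le> M" "0 < r"
    "\<And>h. norm h \<le> r \<Longrightarrow> shift_energy u h \<le> ennreal (M * norm h powr (5 / 4))"
proof -
  define g where "g h = (LINT x|lborel. (u (x + h) - u x)\<^sup>2)" for h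
  define A where "A = avg_const TYPE('a) * 2 powr (real DIM('a) + 2 * s)"
  define E where "E = (LINT z|(lborel \<Otimes>\<^sub>M lborel). energy_density s u u z)"
  define B where "B = A * (2 * L / c)"
  \<comment> \<open>For \<open>norm h \<le> r\<close> the last term of
    \<open>second_difference_le\<close> is at most \<open>1 / 2 * g h\<close>. This leaves
    \<open>7 / 2 * g h \<le> 5 / 4 * g (2 *\<^sub>R h)\<close>, whence the factor
    \<open>5 / 14\<close>.\<close>
  define r where "r = min 1 ((1 / (10 * B + 1)) powr (1 / (2 * s)))"
  \<comment> \<open>For \<open>norm h \<ge> r / 2\<close> this makes
    \<open>M * norm h powr (5 / 4)\<close> at least \<open>A * E\<close>, the bound for
    \<open>g h\<close> when \<open>norm h \<le> 1\<close>.\<close>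
  define M where "M = A * E * (2 / r) powr (5 / 4)"
  have A: "0 \<le> A" by (simp add: A_def avg_const_nonneg)
  have B: "0 \<le> B" using A L_nonneg c_pos by (simp add: B_def)
  have E: "0 \<le> E" unfolding E_def by (rule Bochner_Integration.integral_nonneg) (simp add: energy_density_nonneg)
  have r: "0 < r" "r \<le> 1" using B by (simp_all add: r_def)
  have M: "0 \<le> M" using A E by (simp add: M_def)
  have g_nonneg: "0 \<le> g h" for h unfolding g_def by (rule Bochner_Integration.integral_nonneg) simp
  have contract: "g h \<le> 5 / 14 * g (2 *\<^sub>R h)" if h: "h \<noteq> 0" "norm h \<le> r" for h
  proof -
    have "norm h powr (2 * s) \<le> ((1 / (10 * B + 1)) powr (1 / (2 * s))) powr (2 * s)"
      using h s by (intro powr_mono2) (auto simp: r_def)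
    also have "\<dots> = 1 / (10 * B + 1)" using s B by (simp add: powr_powr)
    finally have "B * norm h powr (2 * s) \<le> B * (1 / (10 * B + 1))"
      using B by (rule mult_left_mono)
    also have "\<dots> \<le> 1 / 10" using B by (simp add: field_simps)
    finally have "5 * (B * norm h powr (2 * s)) * g h \<le> 1 / 2 * g h"
      using g_nonneg by (intro mult_right_mono) auto
    moreover have "4 * g h \<le> 5 / 4 * g (2 *\<^sub>R h) + 5 * (B * norm h powr (2 * s)) * g h"
      using second_difference_le[OF h(1)] by (simp add: g_def B_def A_def mult_ac)
    ultimately show ?thesis by linarith
  qed
  have base: "g h \<le> A * E" if "h \<noteq> 0" "norm h \<le> 1" for h
  proof -
    have "g h \<le> A * norm h powr (2 * s) * E"
      unfolding g_def A_def E_def using integral_shift_le[OF u_measurable s(1) that(1) integrable_energy] .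
    also have "\<dots> \<le> A * 1 * E"
      using that s A E by (intro mult_right_mono mult_left_mono powr_le1) auto
    finally show ?thesis by simp
  qed
  \<comment> \<open>Induction over dyadic shells: if \<open>norm h \<le> r / 2\<close>, then
    \<open>2 *\<^sub>R h\<close> lies in the range of the induction hypothesis.\<close>
  have iter: "g h \<le> M * norm h powr (5 / 4)" if "r / 2 ^ Suc n \<le> norm h" "norm h \<le> r" for n h
    using that
  proof (induction n arbitrary: h)
    case 0
    have h: "h \<noteq> 0" using 0 r by auto
    have "1 \<le> (2 / r * norm h) powr (5 / 4)"
      using 0 r by (intro ge_one_powr_ge_zero) (auto simp: field_simps)
    also have "\<dots> = (2 / r) powr (5 / 4) * norm h powr (5 / 4)"
      using r by (subst powr_mult) auto
    finally have "A * E * 1 \<le> A * E * ((2 / r) powr (5 / 4) * norm h powr (5 / 4))"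
      using A E by (intro mult_left_mono) auto
    then show ?case using base[OF h] 0 r by (simp add: M_def mult_ac)
  next
    case (Suc n)
    show ?case
    proof (cases "norm h \<le> r / 2")
      case False
      have "r * 1 \<le> r * 2 ^ n" using r by (intro mult_left_mono one_le_power) auto
      then have "r / 2 ^ Suc n \<le> r / 2" by (simp add: field_simps)
      then show ?thesis using False Suc.prems(2) by (intro Suc.IH) auto
    next
      case True
      have h: "h \<noteq> 0" using Suc.prems(1) r
        by (metis divide_pos_pos norm_zero not_le zero_less_numeral zero_less_power)
      have "g h \<le> 5 / 14 * g (2 *\<^sub>R h)" using contract[OF h] Suc.prems by simp
      also have "\<dots> \<le> 5 / 14 * (M * norm (2 *\<^sub>R h) powr (5 / 4))"
        using Suc.prems True by (intro mult_left_mono Suc.IH) (auto simp: field_simps)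
      also have "norm (2 *\<^sub>R h) powr (5 / 4) = 2 powr (5 / 4) * norm h powr (5 / 4)"
        by (simp add: powr_mult)
      also have "5 / 14 * (M * (2 powr (5 / 4) * norm h powr (5 / 4))) \<le> M * norm h powr (5 / 4)"
      proof -
        \<comment> \<open>Since \<open>2 ^ 5 = 32\<close> is less than \<open>(14 / 5) ^ 4\<close>,
          which is about 61, doubling \<open>h\<close> costs a factor of at most
          \<open>14 / 5\<close>, which the contraction regains.\<close>
        have "(2::real) powr (5 / 4) = 2 powr (5 * (1 / 4))" by simp
        also have "\<dots> = (2 powr 5) powr (1 / 4)" by (rule powr_powr[symmetric])
        also have "\<dots> \<le> ((14 / 5) powr 4) powr (1 / 4)" by (intro powr_mono2) (auto simp: power_divide)
        also have "\<dots> = 14 / 5" by (simp only: powr_powr) simp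
        finally have "5 / 14 * 2 powr (5 / 4) \<le> (1::real)" by simp
        then have "5 / 14 * 2 powr (5 / 4) * (M * norm h powr (5 / 4)) \<le> 1 * (M * norm h powr (5 / 4))"
          using M by (intro mult_right_mono) auto
        then show ?thesis by (simp add: mult_ac)
      qed
      finally show ?thesis .
    qed
  qed
  show ?thesis
  proof (rule that[OF M r(1)])
    fix h :: 'a assume h: "norm h \<le> r"
    show "shift_energy u h \<le> ennreal (M * norm h powr (5 / 4))"
    proof (cases "h = 0")
      case True
      then show ?thesis by (simp add: shift_energy_def)
    next
      case False
      obtain n where "(1 / 2) ^ n < norm h / r"
        using real_arch_pow_inv[of "norm h / r" "1 / 2"] False r by auto
      moreover have "r / 2 ^ Suc n \<le> r * (1 / 2) ^ n" using r by (simp add: power_divide field_simps)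
      ultimately have "r / 2 ^ Suc n \<le> norm h" using r by (simp add: field_simps)
      then have "g h \<le> M * norm h powr (5 / 4)" using iter h by blast
      then show ?thesis
        unfolding shift_energy_def g_def
        by (subst nn_integral_eq_integral[OF integrable_shift[OF u_measurable s(1) False integrable_energy]])
          (auto intro: ennreal_leI)
    qed
  qed
qed

end

subsection \<open>First-order expansion of the Jacobian and the kernel\<close>

text \<open>Caratheodory's form \<open>\<phi> z = g z * z\<close> of the derivative also covers
  indices with \<open>w m = 0\<close>, where a quotient by \<open>d m * w m\<close> would be
  meaningless.\<close>

lemma tendsto_difference_quotient:
  fixes \<phi> :: "real \<Rightarrow> real"
  assumes "DERIV \<phi> 0 :> D" "\<phi> 0 = 0" "(d \<longlongrightarrow> 0) G" "\<And>m. d m \<noteq> 0" "(w \<longlongrightarrow> l) G"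
  shows "((\<lambda>m. \<phi> (d m * w m) / d m) \<longlongrightarrow> D * l) G"
proof -
  obtain g where g: "\<And>z. \<phi> z = g z * z" "isCont g 0" "g 0 = D"
    using assms(1,2) unfolding CARAT_DERIV by auto
  have "((\<lambda>m. d m * w m) \<longlongrightarrow> 0 * l) G"
    by (intro tendsto_mult assms)
  then have "((\<lambda>m. g (d m * w m)) \<longlongrightarrow> D) G"
    using isCont_tendsto_compose[OF g(2), of "\<lambda>m. d m * w m"] g(3) by simp
  then have "((\<lambda>m. g (d m * w m) * w m) \<longlongrightarrow> D * l) G"
    by (intro tendsto_mult assms)
  moreover have "g (d m * w m) * w m = \<phi> (d m * w m) / d m" for m
    using assms(4)[of m] by (simp add: g(1))
  ultimately show ?thesis by simp
qed

lemma tendsto_ln_quotient: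
  assumes "(d \<longlongrightarrow> 0) G" "\<And>m. d m \<noteq> (0::real)" "(w \<longlongrightarrow> l) G"
  shows "((\<lambda>m. ln (1 + d m * w m) / d m) \<longlongrightarrow> l) G"
proof -
  have "((\<lambda>y::real. ln (1 + y)) has_real_derivative 1) (at 0)"
    by (auto intro!: derivative_eq_intros)
  from tendsto_difference_quotient[OF this _ assms] show ?thesis by simp
qed

lemma tendsto_exp_quotient:
  assumes "(d \<longlongrightarrow> 0) G" "\<And>m. d m \<noteq> (0::real)" "((\<lambda>m. y m / d m) \<longlongrightarrow> l) G"
  shows "((\<lambda>m. (exp (y m) - 1) / d m) \<longlongrightarrow> l) G"
proof -
  have "((\<lambda>y::real. exp y - 1) has_real_derivative 1) (at 0)"
    by (auto intro!: derivative_eq_intros)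
  from tendsto_difference_quotient[OF this _ assms] show ?thesis
    using assms(2) by simp
qed

text \<open>From \<open>1 - \<bar>y\<bar> \<le> exp (- \<bar>y\<bar>)\<close>. It turns bounds on
  logarithms into the dominating functions for the limit below.\<close>

lemma abs_exp_minus_one_le: "\<bar>exp y - 1\<bar> \<le> \<bar>y\<bar> * exp \<bar>y\<bar>" for y :: real
proof -
  have "(1 - \<bar>y\<bar>) * exp \<bar>y\<bar> \<le> exp (- \<bar>y\<bar>) * exp \<bar>y\<bar>"
    using exp_ge_add_one_self[of "- \<bar>y\<bar>"] by (intro mult_right_mono) auto
  then have "exp \<bar>y\<bar> - 1 \<le> \<bar>y\<bar> * exp \<bar>y\<bar>"
    by (simp add: algebra_simps flip: exp_add)
  moreover have "\<bar>exp y - 1\<bar> \<le> exp \<bar>y\<bar> - 1"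
  proof (cases "0 \<le> y")
    case False
    then have "\<bar>y\<bar> = - y" "exp y < 1" by simp_all
    then show ?thesis
      using exp_ge_add_one_self[of y] exp_ge_add_one_self[of "- y"]
      by (simp only: \<open>\<bar>y\<bar> = - y\<close>)
  qed auto
  ultimately show ?thesis by linarith
qed

lemma abs_ln_one_plus_le:
  fixes y :: real
  assumes "\<bar>y\<bar> \<le> 1 / 2"
  shows "\<bar>ln (1 + y)\<bar> \<le> 2 * \<bar>y\<bar>"
proof -
  have "\<bar>ln (1 + y) - y\<bar> \<le> 2 * y\<^sup>2"
    by (rule abs_ln_one_plus_x_minus_x_bound) (use assms in simp)
  also have "2 * y\<^sup>2 = 2 * (\<bar>y\<bar> * \<bar>y\<bar>)" by (simp add: power2_eq_square)
  also have "\<dots> \<le> 2 * (1 / 2 * \<bar>y\<bar>)"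
    using assms by (intro mult_left_mono mult_right_mono) auto
  finally show ?thesis by linarith
qed

context warp
begin

text \<open>Logarithms turn the Jacobian and the kernel weight into sums of terms of first order in
  \<open>t\<close>, which are bounded uniformly and expanded one by one.\<close>

definition log_inv_jac :: "'a \<Rightarrow> real" where
  "log_inv_jac y = - (\<Sum>b\<in>Basis. ln (1 + t * cos ((inv_map y \<bullet> b) / R)))"

definition log_ratio :: "'a \<Rightarrow> 'a \<Rightarrow> real" where
  "log_ratio x y = ln (norm (x - y) / norm (inv_map x - inv_map y))"

lemma inv_jac_eq_exp: "inv_jac y = exp (log_inv_jac y)"
proof -
  have "exp (\<Sum>b\<in>(Basis::'a set). ln (1 + t * cos ((inv_map y \<bullet> b) / R))) = jac (inv_map y)"
    unfolding jac_def exp_sum[OF finite_Basis]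
    by (intro prod.cong refl exp_ln) (rule less_le_trans[OF _ jac_factor(1)], simp)
  then show ?thesis by (simp add: inv_jac_def log_inv_jac_def exp_minus inverse_eq_divide)
qed

lemma kernel_weight_eq_exp:
  "x \<noteq> y \<Longrightarrow> kernel_weight p (x, y) = exp (log_inv_jac x + log_inv_jac y + p * log_ratio x y)"
proof -
  assume "x \<noteq> y"
  then have "inv_map x \<noteq> inv_map y" using map_inv_map by metis
  then show ?thesis using \<open>x \<noteq> y\<close>
    by (simp add: kernel_weight_def inv_jac_eq_exp log_ratio_def powr_def exp_add)
qed

lemma log_inv_jac_le: "\<bar>log_inv_jac y\<bar> \<le> 2 * DIM('a) * \<bar>t\<bar>"
proof -
  have "\<bar>log_inv_jac y\<bar> \<le> (\<Sum>b\<in>(Basis::'a set). 2 * \<bar>t\<bar>)"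
    unfolding log_inv_jac_def abs_minus_cancel
  proof (intro order_trans[OF sum_abs] sum_mono)
    fix b :: 'a
    have c: "\<bar>t * cos ((inv_map y \<bullet> b) / R)\<bar> \<le> \<bar>t\<bar> * 1"
      unfolding abs_mult by (intro mult_left_mono) auto
    then show "\<bar>ln (1 + t * cos ((inv_map y \<bullet> b) / R))\<bar> \<le> 2 * \<bar>t\<bar>"
      using abs_ln_one_plus_le[of "t * cos ((inv_map y \<bullet> b) / R)"] t_le by linarith
  qed
  then show ?thesis by simp
qed

text \<open>The truncated form of the vector field \<open>x\<close> that generates dilations:
  bounded, with Lipschitz constant 1, and tending to \<open>x\<close> as \<open>R\<close>
  grows.\<close>

definition scaled_sin :: "'a \<Rightarrow> 'a" where
  "scaled_sin x = (\<Sum>b\<in>Basis. (R * sin ((x \<bullet> b) / R)) *\<^sub>R b)"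

lemma scaled_sin_inner [simp]: "b \<in> Basis \<Longrightarrow> scaled_sin x \<bullet> b = R * sin ((x \<bullet> b) / R)"
  by (simp add: scaled_sin_def)

lemma map_eq: "map x = x + h + t *\<^sub>R scaled_sin x"
  by (rule euclidean_eqI) (simp add: inner_add_left coord_def)

lemma norm_scaled_sin_diff_le: "norm (scaled_sin x - scaled_sin y) \<le> norm (x - y)"
  using norm_le_componentwise_mult[of 1 "scaled_sin x - scaled_sin y" "x - y"] sin_scaled_diff_le
  by (simp add: inner_diff_left)

lemma diff_eq_inv_map_diff:
  "x - y = (inv_map x - inv_map y) + t *\<^sub>R (scaled_sin (inv_map x) - scaled_sin (inv_map y))"
proof -
  have "map (inv_map x) - map (inv_map y) =
      (inv_map x - inv_map y) + t *\<^sub>R (scaled_sin (inv_map x) - scaled_sin (inv_map y))"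
    unfolding map_eq by (simp add: algebra_simps)
  then show ?thesis by simp
qed

text \<open>As \<open>scaled_sin\<close> does not increase distances, \<open>norm (x - y)\<close>
  differs from the distance of the preimages by at most \<open>\<bar>t\<bar>\<close> times the
  latter, so the quotient is within \<open>\<bar>t\<bar>\<close> of 1.\<close>

lemma log_ratio_le:
  assumes "x \<noteq> y"
  shows "\<bar>log_ratio x y\<bar> \<le> 2 * \<bar>t\<bar>"
proof -
  define X where "X = inv_map x - inv_map y"
  define Z where "Z = scaled_sin (inv_map x) - scaled_sin (inv_map y)"
  have X: "0 < norm X" using assms map_inv_map unfolding X_def by (metis right_minus_eq zero_less_norm_iff)
  have "\<bar>norm (x - y) - norm X\<bar> \<le> norm (t *\<^sub>R Z)"
    using norm_triangle_ineq3[of "x - y" X] diff_eq_inv_map_diff[of x y] by (simp add: X_def Z_def)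
  also have "\<dots> \<le> \<bar>t\<bar> * norm X"
    using norm_scaled_sin_diff_le by (simp add: X_def Z_def mult_left_mono)
  finally have "\<bar>norm (x - y) / norm X - 1\<bar> \<le> \<bar>t\<bar>"
    using X by (simp add: field_simps abs_le_iff)
  then show ?thesis
    using abs_ln_one_plus_le[of "norm (x - y) / norm X - 1"] t_le
    by (simp add: log_ratio_def X_def)
qed

lemma inv_jac_minus_one_le: "\<bar>inv_jac y - 1\<bar> \<le> 2 * DIM('a) * exp (2 * DIM('a)) * \<bar>t\<bar>"
proof -
  have "\<bar>inv_jac y - 1\<bar> \<le> \<bar>log_inv_jac y\<bar> * exp \<bar>log_inv_jac y\<bar>"
    unfolding inv_jac_eq_exp by (rule abs_exp_minus_one_le)
  also have "\<dots> \<le> 2 * DIM('a) * \<bar>t\<bar> * exp (2 * DIM('a) * 1)"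
    using log_inv_jac_le[of y] t_le
    by (intro mult_mono) (auto intro!: order_trans[OF log_inv_jac_le] mult_left_mono)
  finally show ?thesis by (simp add: mult_ac)
qed

text \<open>The exponent of the weight has two Jacobian terms of size
  \<open>2 * DIM('a) * \<bar>t\<bar>\<close> and a kernel term of size
  \<open>2 * p * \<bar>t\<bar>\<close>. After division by \<open>t\<close> the bound depends neither
  on the deformation nor on the points, as dominated convergence requires.\<close>

lemma kernel_weight_minus_one_le:
  fixes p :: real
  assumes p: "0 \<le> p" and "x \<noteq> y"
  shows "\<bar>kernel_weight p (x, y) - 1\<bar> \<le> (4 * DIM('a) + 2 * p) * exp (4 * DIM('a) + 2 * p) * \<bar>t\<bar>"
proof -
  define e where "e = log_inv_jac x + log_inv_jac y + p * log_ratio x y"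
  have "\<bar>p * log_ratio x y\<bar> \<le> p * (2 * \<bar>t\<bar>)"
    unfolding abs_mult using p log_ratio_le[OF assms(2)] by (intro mult_mono) auto
  then have e: "\<bar>e\<bar> \<le> (4 * DIM('a) + 2 * p) * \<bar>t\<bar>"
    using log_inv_jac_le[of x] log_inv_jac_le[of y] unfolding e_def by (simp add: algebra_simps)
  also have "\<dots> \<le> (4 * DIM('a) + 2 * p) * 1" using t_le p by (intro mult_left_mono) auto
  finally have e': "\<bar>e\<bar> \<le> 4 * DIM('a) + 2 * p" by simp
  have "\<bar>kernel_weight p (x, y) - 1\<bar> \<le> \<bar>e\<bar> * exp \<bar>e\<bar>"
    unfolding kernel_weight_eq_exp[OF assms(2)] e_def by (rule abs_exp_minus_one_le)
  also have "\<dots> \<le> ((4 * DIM('a) + 2 * p) * \<bar>t\<bar>) * exp (4 * DIM('a) + 2 * p)"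
    using e e' p by (intro mult_mono) auto
  finally show ?thesis by (simp add: mult_ac)
qed

lemma inv_map_displacement: "norm (inv_map y - y) \<le> norm h + DIM('a) * (\<bar>t\<bar> * R)"
  using map_displacement[of "inv_map y"] by (simp add: norm_minus_commute)

end

text \<open>Because \<open>\<bar>t\<bar> * R\<close> tends to 0, points stay fixed in the limit,
  while \<open>scaled_sin\<close> becomes the field of the dilation as \<open>R\<close> tends to
  infinity. The cosines tend to 1, so each of the \<open>DIM('a)\<close> logarithms divided by
  \<open>t\<close> tends to 1.\<close>

lemma
  fixes t R :: "nat \<Rightarrow> real" and x :: "'a::euclidean_space"
  assumes W: "\<And>m. warp (t m) (R m)" and t0: "\<And>m. t m \<noteq> 0" "t \<longlonglongrightarrow> 0"
    and R: "filterlim R at_top sequentially" and tR: "(\<lambda>m. \<bar>t m\<bar> * R m) \<longlonglongrightarrow> 0"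
  shows inv_map_tendsto: "(\<lambda>m. warp.inv_map 0 (t m) (R m) x) \<longlonglongrightarrow> x"
    and scaled_sin_tendsto: "(\<lambda>m. warp.scaled_sin (R m) (warp.inv_map 0 (t m) (R m) x)) \<longlonglongrightarrow> x"
    and log_inv_jac_tendsto: "(\<lambda>m. warp.log_inv_jac 0 (t m) (R m) x / t m) \<longlonglongrightarrow> - real DIM('a)"
proof -
  let ?X = "\<lambda>m. warp.inv_map 0 (t m) (R m) x"
  have R_pos: "0 < R m" for m using W[of m] by (simp add: warp_def)
  have Rinv: "(\<lambda>m. inverse (R m)) \<longlonglongrightarrow> 0"
    by (rule tendsto_inverse_0_at_top[OF R])
  have "(\<lambda>m. ?X m - x) \<longlonglongrightarrow> 0"
  proof (rule Lim_null_comparison)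
    show "\<forall>\<^sub>F m in sequentially. norm (?X m - x) \<le> DIM('a) * (\<bar>t m\<bar> * R m)"
      using warp.inv_map_displacement[OF W, of "0::'a"] by (intro always_eventually) simp
    show "(\<lambda>m. DIM('a) * (\<bar>t m\<bar> * R m)) \<longlonglongrightarrow> 0" by (rule tendsto_mult_right_zero[OF tR])
  qed
  then show X: "?X \<longlonglongrightarrow> x" by (simp add: LIM_zero_iff)
  then have Xb: "(\<lambda>m. ?X m \<bullet> b) \<longlonglongrightarrow> x \<bullet> b" for b by (intro tendsto_intros)
  have "(\<lambda>m. \<Sum>b\<in>Basis. (R m * sin ((?X m \<bullet> b) / R m)) *\<^sub>R b) \<longlonglongrightarrow> (\<Sum>b\<in>Basis. (x \<bullet> b) *\<^sub>R b)"
  proof (intro tendsto_intros)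
    fix b :: 'a
    \<comment> \<open>\<open>R * sin (y / R)\<close> is a difference quotient of the sine at 0 with
      small parameter \<open>inverse R\<close>.\<close>
    have "(\<lambda>m. sin (inverse (R m) * (?X m \<bullet> b)) / inverse (R m)) \<longlonglongrightarrow> 1 * (x \<bullet> b)"
      using R_pos by (intro tendsto_difference_quotient Rinv Xb)
        (auto intro!: derivative_eq_intros simp: less_imp_neq[symmetric])
    then show "(\<lambda>m. R m * sin ((?X m \<bullet> b) / R m)) \<longlonglongrightarrow> x \<bullet> b"
      by (simp add: divide_inverse mult.commute)
  qed
  then show "(\<lambda>m. warp.scaled_sin (R m) (?X m)) \<longlonglongrightarrow> x"
    by (simp add: warp.scaled_sin_def[OF W] euclidean_representation)
  have "(\<lambda>m. \<Sum>b\<in>(Basis::'a set). ln (1 + t m * cos ((?X m \<bullet> b) / R m)) / t m) \<longlonglongrightarrow>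
      (\<Sum>b\<in>(Basis::'a set). 1)"
  proof (intro tendsto_sum tendsto_ln_quotient t0)
    fix b :: 'a
    have "(\<lambda>m. (?X m \<bullet> b) * inverse (R m)) \<longlonglongrightarrow> (x \<bullet> b) * 0"
      by (intro tendsto_mult Xb Rinv)
    from tendsto_cos[OF this] show "(\<lambda>m. cos ((?X m \<bullet> b) / R m)) \<longlonglongrightarrow> 1"
      by (simp add: divide_inverse)
  qed
  from tendsto_minus[OF this] show "(\<lambda>m. warp.log_inv_jac 0 (t m) (R m) x / t m) \<longlonglongrightarrow> - real DIM('a)"
    by (simp add: warp.log_inv_jac_def[OF W] sum_divide_distrib)
qed

text \<open>Squared norms can be expanded: the difference of the preimages is
  \<open>(x - y) - t m *\<^sub>R Z m\<close>, with squared norm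
  \<open>(norm (x - y))\<^sup>2 * (1 + t m * e m)\<close>, and \<open>e m\<close> tends to
  \<open>- 2\<close>. Then \<open>log_ratio\<close> is \<open>- 1 / 2\<close> times
  \<open>ln (1 + t m * e m)\<close>.\<close>

lemma log_ratio_tendsto:
  fixes t R :: "nat \<Rightarrow> real" and x y :: "'a::euclidean_space"
  assumes W: "\<And>m. warp (t m) (R m)" and t0: "\<And>m. t m \<noteq> 0" "t \<longlonglongrightarrow> 0"
    and R: "filterlim R at_top sequentially" and tR: "(\<lambda>m. \<bar>t m\<bar> * R m) \<longlonglongrightarrow> 0"
    and xy: "x \<noteq> y"
  shows "(\<lambda>m. warp.log_ratio 0 (t m) (R m) x y / t m) \<longlonglongrightarrow> 1"
proof -
  let ?X = "\<lambda>m. warp.inv_map 0 (t m) (R m) x - warp.inv_map 0 (t m) (R m) y"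
  define Z where "Z m = warp.scaled_sin (R m) (warp.inv_map 0 (t m) (R m) x) -
     warp.scaled_sin (R m) (warp.inv_map 0 (t m) (R m) y)" for m
  define e where "e m = (t m * (Z m \<bullet> Z m) - 2 * ((x - y) \<bullet> Z m)) / (norm (x - y))\<^sup>2" for m
  have n: "0 < norm (x - y)" using xy by simp
  have Z: "Z \<longlonglongrightarrow> x - y"
    unfolding Z_def by (intro tendsto_diff scaled_sin_tendsto[OF W t0 R tR])
  have "e \<longlonglongrightarrow> (0 * ((x - y) \<bullet> (x - y)) - 2 * ((x - y) \<bullet> (x - y))) / (norm (x - y))\<^sup>2"
    unfolding e_def[abs_def] using n by (intro tendsto_intros t0 Z) auto
  then have e: "e \<longlonglongrightarrow> - 2" using n by (simp add: power2_norm_eq_inner)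
  have "(\<lambda>m. - (1 / 2) * (ln (1 + t m * e m) / t m)) \<longlonglongrightarrow> - (1 / 2) * - 2"
    by (intro tendsto_mult tendsto_const tendsto_ln_quotient t0 e)
  moreover have "warp.log_ratio 0 (t m) (R m) x y / t m = - (1 / 2) * (ln (1 + t m * e m) / t m)" for m
  proof -
    interpret warp "0::'a" "t m" "R m" by (rule W)
    have X: "?X m = (x - y) - t m *\<^sub>R Z m"
      using diff_eq_inv_map_diff[of x y] unfolding Z_def by (simp add: algebra_simps)
    have X0: "?X m \<noteq> 0" using xy map_inv_map by (metis right_minus_eq)
    have "(norm (?X m))\<^sup>2 = (norm (x - y))\<^sup>2 * (1 + t m * e m)"
    proof -
      have "(norm (?X m))\<^sup>2 = (norm (x - y))\<^sup>2 + t m * (t m * (Z m \<bullet> Z m) - 2 * ((x - y) \<bullet> Z m))"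
        unfolding X power2_norm_eq_inner
        by (simp add: inner_diff_left inner_diff_right inner_commute algebra_simps)
      then show ?thesis using n by (simp add: e_def distrib_left)
    qed
    then have eq: "1 + t m * e m = (norm (?X m) / norm (x - y))\<^sup>2"
      using n by (simp add: power_divide field_simps)
    have "ln (1 + t m * e m) = 2 * ln (norm (?X m) / norm (x - y))"
      unfolding eq using X0 n by (subst ln_realpow) auto
    then have "log_ratio x y = - (1 / 2) * ln (1 + t m * e m)"
      using X0 n by (simp add: log_ratio_def ln_div field_simps)
    then show ?thesis by simp
  qed
  ultimately show ?thesis by simp
qed

subsection \<open>The identity\<close>

lemma (in bounded_solution) pohozaev:
  "(real DIM('a) - 2 * s) * (LINT x|lborel. f (u x) * u x) = 2 * real DIM('a) * (LINT x|lborel. F (u x))"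
proof -
  let ?N = "real DIM('a)"
  let ?p = "?N + 2 * s"
  let ?L = "lborel \<Otimes>\<^sub>M lborel :: ('a \<times> 'a) measure"
  \<comment> \<open>Starting at 2 ensures \<open>\<bar>t m\<bar> \<le> 1 / 2\<close> below.\<close>
  define R :: "nat \<Rightarrow> real" where "R m = real (m + 2)" for m
  \<comment> \<open>The limit of the difference quotients in \<open>t\<close> of twice the action:
    those of the kernel weight tend to \<open>- (?N - 2 * s)\<close>, those of the Jacobian to
    \<open>- ?N\<close>.\<close>
  define \<Lambda> where "\<Lambda> = c * (LINT z|?L. - (?N - 2 * s) * energy_density s u u z) -
    2 * (LINT x|lborel. - ?N * F (u x))"
  have R2: "2 \<le> R m" for m by (simp add: R_def)
  have R_top: "filterlim R at_top sequentially"
    unfolding R_def by (rule filterlim_compose[OF filterlim_real_sequentially filterlim_add_const_nat_at_top])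
  have R_inv: "(\<lambda>m. 1 / R m ^ k) \<longlonglongrightarrow> 0" if "0 < k" for k
    by (rule tendsto_divide_0[OF tendsto_const filterlim_at_top_imp_at_infinity[OF filterlim_pow_at_top[OF that R_top]]])
  obtain M r where M: "0 \<le> M" and r: "0 < r"
    and decay: "\<And>h. norm h \<le> r \<Longrightarrow> shift_energy u h \<le> ennreal (M * norm h powr (5 / 4))"
    using shift_decay by blast
  define K where "K = avg_const TYPE('a) * unit_ball_vol ?N * 2 ^ DIM('a)"
  have K: "0 \<le> K" by (simp add: K_def avg_const_nonneg)
  have nonneg: "0 \<le> \<sigma> * \<Lambda>" if \<sigma>: "\<sigma> = 1 \<or> \<sigma> = -1" for \<sigma> :: real
  proof -
    \<comment> \<open>The displacement is of order \<open>R powr (-8)\<close>, so the remainder is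
      of order \<open>R powr (-10)\<close>, small compared to \<open>\<bar>t\<bar>\<close>. Any
      power above 5 would achieve this; 9 is the first integer above 5 for which
      \<open>5 / 4 * (9 - 1)\<close> is an integer.\<close>
    define t where "t m = \<sigma> / R m ^ 9" for m
    have t_abs: "\<bar>t m\<bar> = 1 / R m ^ 9" for m using \<sigma> R2[of m] by (auto simp: t_def)
    have t0: "t m \<noteq> 0" for m using \<sigma> R2[of m] by (auto simp: t_def)
    have W: "warp (t m) (R m)" for m
    proof
      show "0 < R m" using R2[of m] by simp
      have "(2::real) ^ 1 \<le> 2 ^ 9" by simp
      also have "\<dots> \<le> R m ^ 9" using R2[of m] by (intro power_mono) auto
      finally have "1 / R m ^ 9 \<le> 1 / 2" using R2[of m] by (intro divide_left_mono) auto
      then show "\<bar>t m\<bar> \<le> 1 / 2" unfolding t_abs .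
    qed
    have t_lim: "t \<longlonglongrightarrow> 0"
      using tendsto_mult_right_zero[OF R_inv[of 9], of \<sigma>] by (simp add: t_def[abs_def])
    have tR: "\<bar>t m\<bar> * R m = 1 / R m ^ 8" for m
      unfolding t_abs using R2[of m] by (simp add: power_Suc2[of _ 8, simplified])
    have tR_lim: "(\<lambda>m. \<bar>t m\<bar> * R m) \<longlonglongrightarrow> 0"
      unfolding tR by (rule R_inv) simp
    note lims = W t0 t_lim R_top tR_lim
    define kw where "kw m = warp.kernel_weight (0::'a) (t m) (R m) ?p" for m
    define ij where "ij m = warp.inv_jac (0::'a) (t m) (R m)" for m
    have [measurable]: "kw m \<in> borel_measurable (borel \<Otimes>\<^sub>M borel)" for m
      unfolding kw_def by (rule warp.kernel_weight_measurable[OF W])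
    have [measurable]: "ij m \<in> borel_measurable borel" for m
      unfolding ij_def by (rule warp.inv_jac_measurable[OF W])
    have [measurable]: "(\<lambda>x. F (u x)) \<in> borel_measurable borel"
      using borel_measurable_integrable[OF integrable_F] by simp
    define P where "P m = c * (LINT z|?L. (kw m z - 1) / t m * energy_density s u u z) -
      2 * (LINT x|lborel. (ij m x - 1) / t m * F (u x))" for m
    have "P \<longlonglongrightarrow> \<Lambda>"
      unfolding P_def[abs_def] \<Lambda>_def
    proof (intro tendsto_diff tendsto_mult tendsto_const)
      show "(\<lambda>m. LINT z|?L. (kw m z - 1) / t m * energy_density s u u z) \<longlonglongrightarrow>
          (LINT z|?L. - (?N - 2 * s) * energy_density s u u z)"
      proof (rule integral_dominated_convergence)
        let ?w = "\<lambda>z. (4 * ?N + 2 * ?p) * exp (4 * ?N + 2 * ?p) * energy_density s u u z"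
        show "integrable ?L ?w" using integrable_energy by simp
        show "AE z in ?L. (\<lambda>m. (kw m z - 1) / t m * energy_density s u u z) \<longlonglongrightarrow>
            - (?N - 2 * s) * energy_density s u u z"
        proof (rule AE_I2)
          fix z :: "'a \<times> 'a"
          obtain x y where z: "z = (x, y)" by force
          show "(\<lambda>m. (kw m z - 1) / t m * energy_density s u u z) \<longlonglongrightarrow>
            - (?N - 2 * s) * energy_density s u u z"
          proof (cases "x = y")
            case True
            then show ?thesis by (simp add: z energy_density_def)
          next
            case False
            define e where "e m = warp.log_inv_jac 0 (t m) (R m) x + warp.log_inv_jac 0 (t m) (R m) y +
              ?p * warp.log_ratio 0 (t m) (R m) x y" for m
            \<comment> \<open>Two Jacobian terms and \<open>?N + 2 * s\<close> times the kernel term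
              sum up to \<open>- (?N - 2 * s)\<close>.\<close>
            have "(\<lambda>m. warp.log_inv_jac 0 (t m) (R m) x / t m + warp.log_inv_jac 0 (t m) (R m) y / t m +
              ?p * (warp.log_ratio 0 (t m) (R m) x y / t m)) \<longlonglongrightarrow> - ?N + - ?N + ?p * 1"
              by (intro tendsto_add tendsto_mult tendsto_const log_inv_jac_tendsto[OF lims]
                log_ratio_tendsto[OF lims False])
            then have "(\<lambda>m. e m / t m) \<longlonglongrightarrow> - (?N - 2 * s)"
              by (simp add: e_def add_divide_distrib)
            then have "(\<lambda>m. (exp (e m) - 1) / t m) \<longlonglongrightarrow> - (?N - 2 * s)"
              by (rule tendsto_exp_quotient[OF t_lim t0])
            moreover have "kw m z = exp (e m)" for m
              unfolding kw_def z e_def by (rule warp.kernel_weight_eq_exp[OF W False])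
            ultimately show ?thesis by (simp only:) (intro tendsto_mult tendsto_const)
          qed
        qed
        show "AE z in ?L. norm ((kw m z - 1) / t m * energy_density s u u z) \<le> ?w z" for m
        proof (rule AE_I2)
          fix z :: "'a \<times> 'a"
          obtain x y where z: "z = (x, y)" by force
          show "norm ((kw m z - 1) / t m * energy_density s u u z) \<le> ?w z"
          proof (cases "x = y")
            case True
            then show ?thesis by (simp add: z energy_density_def)
          next
            case False
            have "\<bar>(kw m z - 1) / t m\<bar> \<le> (4 * ?N + 2 * ?p) * exp (4 * ?N + 2 * ?p)"
              using warp.kernel_weight_minus_one_le[OF W _ False, of ?p 0 m] s t0[of m]
              by (simp add: kw_def z abs_divide field_simps)
            then show ?thesis
              by (simp only: real_norm_def abs_mult abs_of_nonneg[OF energy_density_nonneg])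
                (rule mult_right_mono, simp_all add: energy_density_nonneg)
          qed
        qed
      qed measurable
      show "(\<lambda>m. LINT x|lborel. (ij m x - 1) / t m * F (u x)) \<longlonglongrightarrow> (LINT x|lborel. - ?N * F (u x))"
      proof (rule integral_dominated_convergence)
        let ?w = "\<lambda>x. 2 * ?N * exp (2 * ?N) * \<bar>F (u x)\<bar>"
        show "integrable lborel ?w" using integrable_F by simp
        show "AE x in lborel. (\<lambda>m. (ij m x - 1) / t m * F (u x)) \<longlonglongrightarrow> - ?N * F (u x)"
        proof (intro AE_I2 tendsto_mult tendsto_const)
          show "(\<lambda>m. (ij m x - 1) / t m) \<longlonglongrightarrow> - ?N" for x
            unfolding ij_def warp.inv_jac_eq_exp[OF W]
            by (rule tendsto_exp_quotient[OF t_lim t0 log_inv_jac_tendsto[OF lims]])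
        qed
        show "AE x in lborel. norm ((ij m x - 1) / t m * F (u x)) \<le> ?w x" for m
        proof (rule AE_I2)
          fix x
          have "\<bar>(ij m x - 1) / t m\<bar> \<le> 2 * ?N * exp (2 * ?N)"
            using warp.inv_jac_minus_one_le[OF W, of 0 m x] t0[of m]
            by (simp add: ij_def abs_divide field_simps)
          then show "norm ((ij m x - 1) / t m * F (u x)) \<le> ?w x"
            unfolding real_norm_def abs_mult by (rule mult_right_mono) simp
        qed
      qed measurable
    qed
    then have "(\<lambda>m. \<sigma> * P m + 2 * L * (K * M * (2 * ?N) powr (5 / 4)) * (1 / R m ^ 1)) \<longlonglongrightarrow>
        \<sigma> * \<Lambda> + 2 * L * (K * M * (2 * ?N) powr (5 / 4)) * 0"
      by (intro tendsto_add tendsto_mult tendsto_const R_inv) auto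
    moreover have "\<forall>\<^sub>F m in sequentially. 0 \<le> \<sigma> * P m + 2 * L * (K * M * (2 * ?N) powr (5 / 4)) * (1 / R m ^ 1)"
    proof -
      have "(\<lambda>m. 2 * (?N * (1 / R m ^ 8))) \<longlonglongrightarrow> 2 * (?N * 0)"
        by (intro tendsto_mult tendsto_const R_inv) simp
      \<comment> \<open>The decay estimate covers translations of length at most \<open>r\<close>,
        and the averaging uses lengths up to twice the displacement.\<close>
      then have "\<forall>\<^sub>F m in sequentially. 2 * (?N * (1 / R m ^ 8)) < r"
        using r by (auto dest: order_tendstoD)
      then show ?thesis
      proof eventually_elim
        case (elim m)
        interpret warp "0::'a" "t m" "R m" by (rule W)
        define d where "d = ?N * (1 / R m ^ 8)"
        have Rp: "0 < R m" using R2[of m] by simp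
        have d: "0 < d" "norm (map x - x) \<le> d" for x
          using Rp map_displacement[of x] unfolding tR by (simp_all add: d_def)
        have "shift_energy u h \<le> ennreal (M * (2 * d) powr (5 / 4))" if "norm h \<le> 2 * d" for h
        proof -
          have "shift_energy u h \<le> ennreal (M * norm h powr (5 / 4))"
            using that elim by (intro decay) (simp add: d_def)
          also have "\<dots> \<le> ennreal (M * (2 * d) powr (5 / 4))"
            using that M by (intro ennreal_leI mult_left_mono powr_mono2) auto
          finally show ?thesis .
        qed
        from displacement_le_shift[OF u_measurable d this]
        have Q: "(\<integral>\<^sup>+ x. ennreal ((u (map x) - u x)\<^sup>2) \<partial>lborel) \<le> ennreal (K * (M * (2 * d) powr (5 / 4)))"
          unfolding K_def[symmetric] using K by (simp add: ennreal_mult')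
        have KM: "0 \<le> K * (M * (2 * d) powr (5 / 4))" using K M by simp
        have sq: "integrable lborel (\<lambda>x. (u (map x) - u x)\<^sup>2)"
          by (rule integrable_of_nn_integral_le[OF _ _ KM Q]) auto
        have "(LINT x|lborel. (u (map x) - u x)\<^sup>2) \<le> K * (M * (2 * d) powr (5 / 4))"
          by (rule integral_le_of_nn_integral_le[OF _ _ KM Q]) auto
        also have "(2 * d) powr (5 / 4) = (2 * ?N) powr (5 / 4) * (1 / R m ^ 10)"
        proof -
          have "2 * d = 2 * ?N * R m powr (- 8)"
            using Rp by (simp add: d_def powr_minus_divide)
          then have "(2 * d) powr (5 / 4) = (2 * ?N) powr (5 / 4) * (R m powr (- 8)) powr (5 / 4)"
            by (simp only: powr_mult)
          also have "(R m powr (- 8)) powr (5 / 4) = R m powr (- 10)"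
            by (simp only: powr_powr) simp
          also have "R m powr (- 10) = 1 / R m ^ 10"
            using Rp by (simp add: powr_minus_divide)
          finally show ?thesis .
        qed
        finally have sq_le: "(LINT x|lborel. (u (map x) - u x)\<^sup>2) \<le>
          K * (M * ((2 * ?N) powr (5 / 4) * (1 / R m ^ 10)))" .
        have "0 \<le> c * (LINT z|?L. energy_density s (\<lambda>x. u (map x) - u x) (\<lambda>x. u (map x) - u x) z)"
          using c_pos by (intro mult_nonneg_nonneg Bochner_Integration.integral_nonneg)
            (auto simp: energy_density_nonneg)
        also have "\<dots> \<le> c * (LINT z|?L. (kw m z - 1) * energy_density s u u z)
          - 2 * (LINT x|lborel. (ij m x - 1) * F (u x)) + 2 * L * (LINT x|lborel. (u (map x) - u x)\<^sup>2)"
          unfolding kw_def ij_def by (rule energy_deformation_le[OF W sq])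
        also have "\<dots> \<le> c * (LINT z|?L. (kw m z - 1) * energy_density s u u z)
          - 2 * (LINT x|lborel. (ij m x - 1) * F (u x)) +
          2 * L * (K * (M * ((2 * ?N) powr (5 / 4) * (1 / R m ^ 10))))"
          using sq_le L_nonneg by (intro add_left_mono mult_left_mono) auto
        also have "c * (LINT z|?L. (kw m z - 1) * energy_density s u u z)
          - 2 * (LINT x|lborel. (ij m x - 1) * F (u x)) = t m * P m"
          unfolding P_def using t0[of m] by (simp add: field_simps)
        \<comment> \<open>Multiplying by \<open>R m ^ 9\<close> turns \<open>t m\<close> into its
          sign \<open>\<sigma>\<close> and leaves the remainder with a factor
          \<open>1 / R m\<close>.\<close>
        finally have "0 \<le> R m ^ 9 * (t m * P m + 2 * L * (K * (M * ((2 * ?N) powr (5 / 4) * (1 / R m ^ 10)))))"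
          using Rp by simp
        also have "\<dots> = \<sigma> * P m + 2 * L * (K * M * (2 * ?N) powr (5 / 4)) * (1 / R m ^ 1)"
        proof -
          have "R m ^ 9 * t m = \<sigma>" using Rp by (simp add: t_def)
          moreover have "R m ^ 9 * (1 / R m ^ 10) = 1 / R m ^ 1"
            using Rp power_Suc2[of "R m" 9] by (simp add: field_simps)
          moreover have "R m ^ 9 * (t m * P m + 2 * L * (K * (M * (Y * q)))) =
              (R m ^ 9 * t m) * P m + 2 * L * (K * M * Y) * (R m ^ 9 * q)" for Y q
            by (simp add: algebra_simps)
          ultimately show ?thesis by (simp only:)
        qed
        finally show ?case .
      qed
    qed
    ultimately show "0 \<le> \<sigma> * \<Lambda>"
      by (intro tendsto_lowerbound[of _ "\<sigma> * \<Lambda>" sequentially]) auto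
  qed
  \<comment> \<open>The two signs of the step give \<open>\<Lambda> \<ge> 0\<close> and
    \<open>\<Lambda> \<le> 0\<close>; the energy is then eliminated by testing the weak equation
    with \<open>u\<close>.\<close>
  have "\<Lambda> = 0" using nonneg[of 1] nonneg[of "-1"] by simp
  moreover have "\<Lambda> = - (?N - 2 * s) * (c * (LINT z|?L. energy_density s u u z)) + 2 * ?N * (LINT x|lborel. F (u x))"
    by (simp add: \<Lambda>_def)
  ultimately show ?thesis
    unfolding weak_self(2) by (simp add: algebra_simps)
qed

section \<open>Taylor's inequality for the primitive of the nonlinearity\<close>

lemma C_class_2_imp:
  fixes f :: "real \<Rightarrow> real"
  assumes "C_class 2 f"
  obtains f' where "\<And>x. (f has_real_derivative f' x) (at x)" "continuous_on UNIV f'"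
proof -
  have f: "C_class (Suc 1) f" using assms by (simp add: numeral_2_eq_2)
  let ?f' = "\<lambda>x. frechet_derivative f (at x) 1"
  have "(f has_real_derivative ?f' x) (at x)" for x
  proof -
    have d: "(f has_derivative frechet_derivative f (at x)) (at x)"
      by (rule C_class_SucD(1)[OF f])
    then have "frechet_derivative f (at x) = (*) (?f' x)"
      by (intro ext)
        (metis has_derivative_linear linear_cmul mult.commute mult.right_neutral real_scaleR_def)
    then show ?thesis using d unfolding has_field_derivative_def by metis
  qed
  moreover have "continuous_on UNIV ?f'"
    using C_class_SucD(2)[OF f, of 1] C_class_Suc_imp[of 0 ?f'] by simp
  ultimately show ?thesis by (rule that)
qed

lemma primitive_has_derivative:
  assumes f: "continuous_on UNIV f" and r: "0 \<le> r"
  shows "(primitive f has_real_derivative f r) (at r)"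
proof -
  \<comment> \<open>The interval extends beyond \<open>[0, r]\<close> on both sides, so that
    \<open>r\<close> is an interior point even for \<open>r = 0\<close>.\<close>
  have "((\<lambda>u. LBINT y=ereal 0..ereal u. f y) has_vector_derivative f r) (at r within {-1..r + 1})"
    by (rule interval_integral_FTC2) (use r in \<open>auto intro: continuous_on_subset[OF f]\<close>)
  moreover have "at r within {-1..r + 1} = at r"
    using r by (intro at_within_interior) auto
  ultimately show ?thesis
    by (simp add: primitive_def[abs_def] has_real_derivative_iff_has_vector_derivative zero_ereal_def)
qed

text \<open>The mean value theorem gives \<open>(b - a) * f \<xi>\<close> with \<open>\<xi>\<close>
  no farther from \<open>a\<close> than \<open>b\<close>, and \<open>f\<close> is Lipschitz on
  \<open>[0, C]\<close> since \<open>f'\<close> is bounded there.\<close>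

lemma primitive_taylor:
  fixes f :: "real \<Rightarrow> real"
  assumes f': "\<And>x. (f has_real_derivative f' x) (at x)" "continuous_on UNIV f'"
  obtains L where "0 \<le> L"
    "\<And>a b. a \<in> {0..C} \<Longrightarrow> b \<in> {0..C} \<Longrightarrow>
      primitive f b - primitive f a - L * (b - a)\<^sup>2 \<le> f a * (b - a)"
proof -
  have cont: "continuous_on UNIV f"
    using f'(1) by (auto intro!: continuous_at_imp_continuous_on DERIV_isCont)
  have "compact (f' ` {0..C})"
    by (intro compact_continuous_image continuous_on_subset[OF f'(2)]) auto
  then obtain L0 where L0: "\<And>x. x \<in> {0..C} \<Longrightarrow> \<bar>f' x\<bar> \<le> L0"
    using compact_imp_bounded by (fastforce simp: bounded_iff)
  \<comment> \<open>For \<open>C < 0\<close> the interval is empty and \<open>L0\<close> may be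
    negative.\<close>
  define L where "L = max L0 0"
  have lip: "\<bar>f y - f x\<bar> \<le> L * \<bar>y - x\<bar>" if "x \<in> {0..C}" "y \<in> {0..C}" for x y
  proof -
    have "norm (f y - f x) \<le> L * norm (y - x)"
    proof (rule field_differentiable_bound)
      show "(f has_field_derivative f' z) (at z within {0..C})" for z
        by (rule has_field_derivative_at_within[OF f'(1)])
      show "norm (f' z) \<le> L" if "z \<in> {0..C}" for z
        using L0[OF that] by (simp add: L_def)
    qed (use that in auto)
    then show ?thesis by simp
  qed
  show ?thesis
  proof (rule that)
    show "0 \<le> L" by (simp add: L_def)
    fix a b assume ab: "a \<in> {0..C}" "b \<in> {0..C}"
    have "\<exists>\<xi>\<in>{0..C}. \<bar>\<xi> - a\<bar> \<le> \<bar>b - a\<bar> \<and> primitive f b - primitive f a = (b - a) * f \<xi>"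
    proof (cases a b rule: linorder_cases)
      case less
      with MVT2[of a b "primitive f" f] primitive_has_derivative[OF cont] ab
      obtain \<xi> where "a < \<xi>" "\<xi> < b" "primitive f b - primitive f a = (b - a) * f \<xi>" by auto
      then show ?thesis using ab by (intro bexI[of _ \<xi>]) auto
    next
      case equal
      then show ?thesis using ab by auto
    next
      case greater
      with MVT2[of b a "primitive f" f] primitive_has_derivative[OF cont] ab
      obtain \<xi> where "b < \<xi>" "\<xi> < a" "primitive f a - primitive f b = (a - b) * f \<xi>" by auto
      then show ?thesis using ab by (intro bexI[of _ \<xi>]) (auto simp: algebra_simps)
    qed
    then obtain \<xi> where \<xi>: "\<xi> \<in> {0..C}" "\<bar>\<xi> - a\<bar> \<le> \<bar>b - a\<bar>"
      "primitive f b - primitive f a = (b - a) * f \<xi>" by blast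
    have "(b - a) * (f \<xi> - f a) \<le> \<bar>b - a\<bar> * \<bar>f \<xi> - f a\<bar>"
      by (metis abs_ge_self abs_mult)
    also have "\<dots> \<le> \<bar>b - a\<bar> * (L * \<bar>b - a\<bar>)"
      using lip[OF ab(1) \<xi>(1)] \<xi>(2) mult_left_mono[OF \<xi>(2) \<open>0 \<le> L\<close>]
      by (intro mult_left_mono) auto
    also have "\<dots> = L * (b - a)\<^sup>2" by (simp add: power2_eq_square flip: abs_mult)
    finally show "primitive f b - primitive f a - L * (b - a)\<^sup>2 \<le> f a * (b - a)"
      using \<xi>(3) by (simp add: algebra_simps)
  qed
qed

section \<open>Functions that agree almost everywhere\<close>

lemma energy_density_AE_cong:
  fixes u v :: "'a::euclidean_space \<Rightarrow> real"
  assumes "AE x in lebesgue. u x = v x" "AE x in lebesgue. u' x = v' x"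
  shows "AE z in lebesgue \<Otimes>\<^sub>M lebesgue. energy_density s u u' z = energy_density s v v' z"
  using AE_pair_lebesgue[OF assms(1)] AE_pair_lebesgue[OF assms(2)]
  by eventually_elim (simp add: energy_density_def split_beta')

lemma energy_density_measurable_lebesgue:
  fixes u v :: "'a::euclidean_space \<Rightarrow> real"
  assumes [measurable]: "u \<in> borel_measurable lebesgue" "v \<in> borel_measurable lebesgue"
  shows "energy_density s u v \<in> borel_measurable (lebesgue \<Otimes>\<^sub>M lebesgue)"
proof -
  have id: "(\<lambda>x::'a. x) \<in> lebesgue \<rightarrow>\<^sub>M borel" by (rule measurable_completion) simp
  have [measurable]: "fst \<in> borel_measurable ((lebesgue :: 'a measure) \<Otimes>\<^sub>M (lebesgue :: 'a measure))"
    by (rule measurable_compose[OF measurable_fst id])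
  have [measurable]: "snd \<in> borel_measurable ((lebesgue :: 'a measure) \<Otimes>\<^sub>M (lebesgue :: 'a measure))"
    by (rule measurable_compose[OF measurable_snd id])
  show ?thesis unfolding energy_density_def split_beta' by measurable
qed

lemma energy_form_AE_cong:
  fixes u v :: "'a::euclidean_space \<Rightarrow> real"
  assumes "u \<in> borel_measurable lebesgue" "v \<in> borel_measurable lebesgue"
    "u' \<in> borel_measurable lebesgue" "v' \<in> borel_measurable lebesgue"
    "AE x in lebesgue. u x = v x" "AE x in lebesgue. u' x = v' x"
  shows "energy_form s u u' = energy_form s v v'"
  unfolding energy_form_def
  using integral_cong_AE[OF energy_density_measurable_lebesgue energy_density_measurable_lebesgue
      energy_density_AE_cong, of u u' v v' s] assms
  by simp

text \<open>The test functions approximating \<open>u\<close> also approximate \<open>v\<close>,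
  since the norm of a measurable function only depends on its class.\<close>

lemma Hdot_AE_cong:
  fixes u v :: "'a::euclidean_space \<Rightarrow> real"
  assumes u: "u \<in> Hdot s" and [measurable]: "v \<in> borel_measurable lebesgue"
    and ae: "AE x in lebesgue. u x = v x"
  shows "v \<in> Hdot s"
proof -
  let ?q = "crit_exp TYPE('a) s"
  have [measurable]: "u \<in> borel_measurable lebesgue"
    using u by (simp add: Hdot_def finite_Hdot_norm_def)
  have "integrable (lebesgue \<Otimes>\<^sub>M lebesgue) (energy_density s v v)"
  proof (rule integrable_cong_AE_imp)
    show "integrable (lebesgue \<Otimes>\<^sub>M lebesgue) (energy_density s u u)"
      using u by (simp add: Hdot_def finite_Hdot_norm_def)
  qed (intro energy_density_measurable_lebesgue energy_density_AE_cong ae assms(2))+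
  moreover have "integrable lebesgue (\<lambda>x. \<bar>v x\<bar> powr ?q)"
  proof (rule integrable_cong_AE_imp)
    show "integrable lebesgue (\<lambda>x. \<bar>u x\<bar> powr ?q)"
      using u by (simp add: Hdot_def finite_Hdot_norm_def)
    show "AE x in lebesgue. \<bar>u x\<bar> powr ?q = \<bar>v x\<bar> powr ?q"
      using ae by eventually_elim simp
  qed measurable
  moreover obtain \<phi> where \<phi>: "\<And>k. test_function (\<phi> k)"
    and lim: "(\<lambda>k::nat. Hdot_norm s (\<lambda>x. u x - \<phi> k x)) \<longlonglongrightarrow> 0"
    using u by (auto simp: Hdot_def)
  have "Hdot_norm s (\<lambda>x. v x - \<phi> k x) = Hdot_norm s (\<lambda>x. u x - \<phi> k x)" for k
  proof -
    have [measurable]: "\<phi> k \<in> borel_measurable lebesgue"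
      by (rule measurable_completion) (use test_function_measurable[OF \<phi>] in simp)
    have d: "AE x in lebesgue. v x - \<phi> k x = u x - \<phi> k x"
      using ae by eventually_elim simp
    have "energy_form s (\<lambda>x. v x - \<phi> k x) (\<lambda>x. v x - \<phi> k x) =
        energy_form s (\<lambda>x. u x - \<phi> k x) (\<lambda>x. u x - \<phi> k x)"
      by (intro energy_form_AE_cong d) measurable
    moreover have "(LINT x|lebesgue. \<bar>v x - \<phi> k x\<bar> powr ?q) = (LINT x|lebesgue. \<bar>u x - \<phi> k x\<bar> powr ?q)"
      by (rule integral_cong_AE; measurable?) (use d in \<open>eventually_elim, simp\<close>)
    ultimately show ?thesis by (simp add: Hdot_norm_def Lp_norm_def)
  qed
  ultimately show ?thesis
    using \<phi> lim by (auto simp: Hdot_def finite_Hdot_norm_def intro!: exI[of _ \<phi>])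
qed

theorem theoremA1:
  fixes s :: real
    and f :: "real \<Rightarrow> real"
    and u :: "'a::euclidean_space \<Rightarrow> real"
  assumes "0 < s" and "s < 1"
    and "real DIM('a) > 2 * s"
    and "C_class 2 f"
    and "u \<in> Hdot s"
    and "essentially_bounded u"
    and "AE x in lebesgue. u x > 0"
    and "weak_solution s f u"
    and "integrable lebesgue (\<lambda>x. primitive f (u x))"
  shows "(real DIM('a) - 2 * s) * (LINT x|lebesgue. u x * f (u x)) =
         2 * real DIM('a) * (LINT x|lebesgue. primitive f (u x))"
proof -
  have u [measurable]: "u \<in> borel_measurable lebesgue"
    using assms(6) by (simp add: essentially_bounded_def)
  obtain C where C: "AE x in lebesgue. \<bar>u x\<bar> \<le> C"
    using assms(6) by (auto simp: essentially_bounded_def)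
  obtain u1 where u1 [measurable]: "u1 \<in> borel_measurable lborel" and u1_eq: "AE x in lborel. u x = u1 x"
    using completion_ex_borel_measurable_real[OF u] by auto
  define C' where "C' = max 0 C"
  \<comment> \<open>The bounds on \<open>u\<close> hold almost everywhere. Clamping a Borel
    representative to \<open>[0, C']\<close> makes them hold at every point and changes it only on a
    null set.\<close>
  define v where "v x = max 0 (min C' (u1 x))" for x
  have v [measurable]: "v \<in> borel_measurable borel" unfolding v_def[abs_def] using u1 by measurable
  then have v_leb [measurable]: "v \<in> borel_measurable lebesgue"
    by (intro measurable_completion) simp
  have uv: "AE x in lebesgue. u x = v x"
    using C assms(7) AE_completion[OF u1_eq] by eventually_elim (auto simp: v_def C'_def)
  have v_Hdot: "v \<in> Hdot s" by (rule Hdot_AE_cong[OF assms(5) v_leb uv])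
  obtain f' where f': "\<And>x. (f has_real_derivative f' x) (at x)" "continuous_on UNIV f'"
    using C_class_2_imp[OF assms(4)] by blast
  then obtain L where L: "0 \<le> L" "\<And>a b. a \<in> {0..C'} \<Longrightarrow> b \<in> {0..C'} \<Longrightarrow>
      primitive f b - primitive f a - L * (b - a)\<^sup>2 \<le> f a * (b - a)"
    using primitive_taylor by metis
  have f_cont: "continuous_on UNIV f"
    using f'(1) by (auto intro!: continuous_at_imp_continuous_on DERIV_isCont)
  then have [measurable]: "f \<in> borel_measurable borel"
    by (rule borel_measurable_continuous_onI)
  have v_range: "v x \<in> {0..C'}" for x by (simp add: v_def C'_def)
  have F_borel [measurable]: "(\<lambda>x. primitive f (v x)) \<in> borel_measurable borel"
  proof -
    \<comment> \<open>Differentiability of the primitive is known on the half-line; composing with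
      \<open>max 0\<close> gives a continuous function on all reals that agrees with it on the
      values of \<open>v\<close>.\<close>
    have "continuous_on {0..} (primitive f)"
      using primitive_has_derivative[OF f_cont]
      by (intro continuous_at_imp_continuous_on) (auto intro: DERIV_isCont)
    then have "continuous_on UNIV (\<lambda>r. primitive f (max 0 r))"
      by (rule continuous_on_compose2) (auto intro!: continuous_intros)
    then have [measurable]: "(\<lambda>r. primitive f (max 0 r)) \<in> borel_measurable borel"
      by (rule borel_measurable_continuous_onI)
    have "(\<lambda>x. primitive f (v x)) = (\<lambda>x. primitive f (max 0 (v x)))"
      using v_range by (simp add: max_def)
    then show ?thesis by simp
  qed
  have F_eq: "AE x in lebesgue. primitive f (u x) = primitive f (v x)"
    using uv by eventually_elim simp
  have F_leb: "integrable lebesgue (\<lambda>x. primitive f (v x))"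
    by (rule integrable_cong_AE_imp[OF assms(9) measurable_completion F_eq]) simp
  \<comment> \<open>The test function \<open>v \<circ> map\<close> lies in the space by
    \<open>Hdot_comp_map\<close>, and replacing the solution \<open>u\<close> by \<open>v\<close>
    changes neither side of the weak equation.\<close>
  have weak: "integrable lborel (\<lambda>x. f (v x) * v (warp.map h t R x)) \<and>
      frac_const TYPE('a) s / 2 * (LINT z|(lborel \<Otimes>\<^sub>M lborel).
        energy_density s v (\<lambda>x. v (warp.map h t R x)) z) =
      (LINT x|lborel. f (v x) * v (warp.map h t R x))" if W: "warp t R" for h :: 'a and t R
  proof -
    interpret warp h t R by fact
    let ?\<phi> = "\<lambda>x. v (map x)"
    have \<phi> [measurable]: "?\<phi> \<in> borel_measurable borel" by measurable
    then have [measurable]: "?\<phi> \<in> borel_measurable lebesgue"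
      by (intro measurable_completion) simp
    have "?\<phi> \<in> Hdot s"
      by (rule Hdot_comp_map[OF assms(1-3) v_Hdot v])
    then have int: "integrable lebesgue (\<lambda>x. f (u x) * ?\<phi> x)"
      and eq: "energy_form s u ?\<phi> = (LINT x|lebesgue. f (u x) * ?\<phi> x)"
      using assms(8) by (auto simp: weak_solution_def)
    have ae: "AE x in lebesgue. f (u x) * ?\<phi> x = f (v x) * ?\<phi> x"
      using uv by eventually_elim simp
    have m: "(\<lambda>x. f (v x) * ?\<phi> x) \<in> borel_measurable lborel" by measurable
    have "integrable lebesgue (\<lambda>x. f (v x) * ?\<phi> x)"
      by (rule integrable_cong_AE_imp[OF int measurable_completion[OF m] ae])
    moreover have "(LINT x|lebesgue. f (u x) * ?\<phi> x) = (LINT x|lebesgue. f (v x) * ?\<phi> x)"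
      by (rule integral_cong_AE[OF _ _ ae]) measurable
    moreover have "energy_form s u ?\<phi> = energy_form s v ?\<phi>"
      by (intro energy_form_AE_cong uv) auto
    ultimately show ?thesis
      using eq m by (simp add: integrable_completion integral_completion energy_form_borel)
  qed
  interpret bounded_solution s f "primitive f" v C' L "frac_const TYPE('a) s / 2"
  proof
    show "0 < frac_const TYPE('a) s / 2" using frac_const_pos[OF assms(1,2), where 'a = 'a] by simp
    show "integrable lborel (\<lambda>x. primitive f (v x))"
      using F_leb by (simp add: integrable_completion)
    show "integrable (lborel \<Otimes>\<^sub>M lborel) (energy_density s v v)"
      using v_Hdot by (simp add: Hdot_def finite_Hdot_norm_def integrable_lebesgue_pair_iff)
  qed (use assms v v_range L weak in auto)
  have "(LINT x|lebesgue. u x * f (u x)) = (LINT x|lebesgue. f (v x) * v x)"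
  proof (rule integral_cong_AE)
    show "AE x in lebesgue. u x * f (u x) = f (v x) * v x"
      using uv by eventually_elim simp
  qed measurable
  also have "\<dots> = (LINT x|lborel. f (v x) * v x)"
    by (rule integral_completion) measurable
  finally have 1: "(LINT x|lebesgue. u x * f (u x)) = (LINT x|lborel. f (v x) * v x)" .
  have "(LINT x|lebesgue. primitive f (u x)) = (LINT x|lebesgue. primitive f (v x))"
    using assms(9) F_leb F_eq by (intro integral_cong_AE) auto
  also have "\<dots> = (LINT x|lborel. primitive f (v x))"
    by (rule integral_completion) simp
  finally show ?thesis using pohozaev 1 by simp
qed

end
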